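(* Let $\{X_{n,k}:n\in\mathbb{N},\ k=1,\ldots,K_n\}$ be a rowwise independent array of random elements in the torus $\mathbb{T}$. Suppose that there exist $a\in\mathbb{T}$, a real number $b\ge0$ and a Lévy measure $\eta$ on $\mathbb{T}$ such that (i) $\max_{1\le k\le K_n}\mathrm{P}(|\arg(X_{n,k})|>\varepsilon)\to0$ as $n\to\infty$ for all $\varepsilon>0$, (ii) $\exp\left\{i\sum_{k=1}^{K_n}\mathrm{E}\,h(\arg(X_{n,k}))\right\}\to a$ as $n\to\infty$, (iii) $\sum_{k=1}^{K_n}\mathrm{Var}\,h(\arg(X_{n,k}))\to b+\int_{\mathbb{T}}\bigl(h(\arg y)\bigr)^2\,d\eta(y)$ as $n\to\infty$, (iv) $\sum_{k=1}^{K_n}\mathrm{E}\,f(X_{n,k})\to\int_{\mathbb{T}}f\,d\eta$ as $n\to\infty$ for all $f\in\mathcal{C}_0(\mathbb{T})$. Then the array $\{X_{n,k}\}$ is infinitesimal, and the distribution of $\sum_{k=1}^{K_n}X_{n,k}$ converges weakly to $\delta_a*\gamma_{\psi_b}*\pi_{\eta,\,g_{\mathbb{T}}}$ as $n\to\infty$.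
   Context: $\mathbb{T}=\{e^{ix}:-\pi\le x<\pi\}$ is the circle group under multiplication of complex numbers, with identity $e=1$; $\sum_{k=1}^{K_n}X_{n,k}$ denotes the group operation applied to $X_{n,1},\ldots,X_{n,K_n}$, i.e. the product of these complex numbers. $\mathbb{N}$ is the set of positive integers. The characters of $\mathbb{T}$ are $\chi_\ell(y)=y^\ell$, $\ell\in\mathbb{Z}$. $\arg:\mathbb{T}\to[-\pi,\pi)$ is given by $\arg(e^{ix})=x$ for $-\pi\le x<\pi$. The function $h:\mathbb{R}\to\mathbb{R}$ is: $h(x)=0$ if $x<-\pi$ or $x\ge\pi$; $h(x)=-x-\pi$ if $-\pi\le x<-\pi/2$; $h(x)=x$ if $-\pi/2\le x<\pi/2$; $h(x)=-x+\pi$ if $\pi/2\le x<\pi$. Put $g_{\mathbb{T}}(y,\chi_\ell)=\ell\,h(\arg y)$. A Borel neighbourhood of $e$ is a Borel set containing an open set that contains $e$. Rowwise independent: for each $n$, $X_{n,1},\ldots,X_{n,K_n}$ are independent. Infinitesimal: $\lim_{n\to\infty}\max_{1\le k\le K_n}\mathrm{P}(X_{n,k}\in\mathbb{T}\setminus U)=0$ for every Borel neighbourhood $U$ of $e$. $\mathcal{C}_0(\mathbb{T})$ is the set of real-valued bounded continuous functions on $\mathbb{T}$ vanishing on some Borel neighbourhood of $e$. A Lévy measure on $\mathbb{T}$ is a $[0,\infty]$-valued Borel measure $\eta$ with $\eta(\{e\})=0$, $\eta(\mathbb{T}\setminus U)<\infty$ for every Borel neighbourhood $U$ of $e$, and $\int_{\mathbb{T}}(1-\mathrm{Re}\,\chi(y))\,d\eta(y)<\infty$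 for every character $\chi$; equivalently, $\eta(\{e\})=0$ and $\int_{\mathbb{T}}(\arg y)^2\,d\eta(y)<\infty$. $\delta_a$ is the Dirac measure at $a$ and $*$ is convolution. $\gamma_{\psi_b}$ is the probability measure on $\mathbb{T}$ with $\int_{\mathbb{T}}y^\ell\,d\gamma_{\psi_b}(y)=e^{-b\ell^2/2}$ for all $\ell\in\mathbb{Z}$. $\pi_{\eta,\,g_{\mathbb{T}}}$ is the probability measure on $\mathbb{T}$ with $\int_{\mathbb{T}}y^\ell\,d\pi_{\eta,\,g_{\mathbb{T}}}(y)=\exp\left\{\int_{\mathbb{T}}\bigl(y^\ell-1-i\ell h(\arg y)\bigr)\,d\eta(y)\right\}$ for all $\ell\in\mathbb{Z}$. (These measures exist and are uniquely determined.) *)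

theory Defs
  imports "HOL-Probability.Probability"
begin

text \<open>
  The circle group is the subset \<open>sphere 0 1\<close> of the complex plane, with complex multiplication;
  measures on it live on the trace \<open>\<sigma>\<close>-algebra of the complex Borel sets.
\<close>

abbreviation torus :: "complex set" where
  "torus \<equiv> sphere 0 1"

definition torus_borel :: "complex measure" where
  "torus_borel = restrict_space borel torus"

definition borel_nhd_one :: "complex set \<Rightarrow> bool" where
  "borel_nhd_one U \<longleftrightarrow>
     U \<in> sets torus_borel \<and> (\<exists>V. openin (top_of_set torus) V \<and> 1 \<in> V \<and> V \<subseteq> U)"

text \<open>
  The library's \<^const>\<open>Arg\<close> takes values in \<open>(-\<pi>, \<pi>]\<close>; here the argument takes values in
  \<open>[-\<pi>, \<pi>)\<close>, which differs at the point \<open>-1\<close> only.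
\<close>

definition torus_arg :: "complex \<Rightarrow> real" where
  "torus_arg y = (if Arg y = pi then - pi else Arg y)"

lemma torus_arg_cis:
  assumes "- pi \<le> x" "x < pi"
  shows "torus_arg (cis x) = x"
proof (cases "x = - pi")
  case True
  have "cis x = - 1" using True by (simp add: complex_eq_iff)
  moreover have "Arg (- 1) = pi" by (intro cis_Arg_unique) (auto simp: sgn_eq complex_eq_iff)
  ultimately show ?thesis by (simp add: torus_arg_def True)
next
  case False
  then have "Arg (cis x) = x" using assms by (intro cis_Arg_unique) (auto simp: sgn_eq)
  then show ?thesis using assms by (simp add: torus_arg_def)
qed

definition trunc_h :: "real \<Rightarrow> real" where
  "trunc_h x =
    (if x < - pi \<or> x \<ge> pi then 0
     else if x < - pi / 2 then - x - pi
     else if x < pi / 2 then x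
     else - x + pi)"

text \<open>The character \<open>\<chi>\<^sub>l\<close> is \<open>y \<mapsto> y powi l\<close>; \<open>torus_g\<close> takes
  the index \<open>l\<close> in place of the character.\<close>

definition torus_g :: "complex \<Rightarrow> int \<Rightarrow> real" where
  "torus_g y l = of_int l * trunc_h (torus_arg y)"

definition levy_measure :: "complex measure \<Rightarrow> bool" where
  "levy_measure \<eta> \<longleftrightarrow>
     sets \<eta> = sets torus_borel \<and>
     emeasure \<eta> {1} = 0 \<and>
     (\<forall>U. borel_nhd_one U \<longrightarrow> emeasure \<eta> (torus - U) < \<infinity>) \<and>
     (\<forall>l::int. (\<integral>\<^sup>+ y. ennreal (1 - Re (y powi l)) \<partial>\<eta>) < \<infinity>)"

definition torus_C0 :: "(complex \<Rightarrow> real) set" where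
  "torus_C0 = {f. continuous_on torus f \<and> bounded (f ` torus) \<and>
                  (\<exists>U. borel_nhd_one U \<and> (\<forall>y\<in>U. f y = 0))}"

definition torus_prob :: "complex measure \<Rightarrow> bool" where
  "torus_prob \<mu> \<longleftrightarrow> prob_space \<mu> \<and> sets \<mu> = sets torus_borel"

definition gauss_measure :: "real \<Rightarrow> complex measure" where
  "gauss_measure b = (THE \<mu>. torus_prob \<mu> \<and>
     (\<forall>l::int. (\<integral>y. y powi l \<partial>\<mu>) = of_real (exp (- b * (of_int l)\<^sup>2 / 2))))"

definition gen_poisson_measure :: "complex measure \<Rightarrow> complex measure" where
  "gen_poisson_measure \<eta> = (THE \<mu>. torus_prob \<mu> \<and>
     (\<forall>l::int. (\<integral>y. y powi l \<partial>\<mu>) =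
        exp (\<integral>y. (y powi l - 1 - \<i> * of_real (torus_g y l)) \<partial>\<eta>)))"

text \<open>The library's \<^const>\<open>convolution\<close> is additive; on the circle the group operation is \<open>*\<close>.\<close>

definition torus_convolution :: "complex measure \<Rightarrow> complex measure \<Rightarrow> complex measure" where
  "torus_convolution \<mu> \<nu> = distr (\<mu> \<Otimes>\<^sub>M \<nu>) torus_borel (\<lambda>(x, y). x * y)"

text \<open>The library's \<^const>\<open>weak_conv_m\<close> concerns measures on the real line only.\<close>

definition torus_weak_conv :: "(nat \<Rightarrow> complex measure) \<Rightarrow> complex measure \<Rightarrow> bool" where
  "torus_weak_conv \<mu> \<nu> \<longleftrightarrow>
     (\<forall>f :: complex \<Rightarrow> real. continuous_on torus f \<and> bounded (f ` torus) \<longrightarrow>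
        (\<lambda>n. \<integral>y. f y \<partial>\<mu> n) \<longlonglongrightarrow> (\<integral>y. f y \<partial>\<nu>))"

text \<open>
  Each row \<open>n \<ge> 1\<close> may live on its own probability space \<open>M n\<close> (a single common space is the
  special case of constant \<open>M\<close>) and has at least one entry; row and column indices start at 1.
\<close>

definition rowwise_independent_array ::
  "(nat \<Rightarrow> 'a measure) \<Rightarrow> (nat \<Rightarrow> nat) \<Rightarrow> (nat \<Rightarrow> nat \<Rightarrow> 'a \<Rightarrow> complex) \<Rightarrow> bool" where
  "rowwise_independent_array M K X \<longleftrightarrow>
     (\<forall>n\<ge>1. prob_space (M n) \<and> 1 \<le> K n \<and>
        (\<forall>k\<in>{1..K n}. X n k \<in> measurable (M n) torus_borel) \<and>
        prob_space.indep_vars (M n) (\<lambda>_. torus_borel) (X n) {1..K n})"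

definition infinitesimal_array ::
  "(nat \<Rightarrow> 'a measure) \<Rightarrow> (nat \<Rightarrow> nat) \<Rightarrow> (nat \<Rightarrow> nat \<Rightarrow> 'a \<Rightarrow> complex) \<Rightarrow> bool" where
  "infinitesimal_array M K X \<longleftrightarrow>
     (\<forall>U. borel_nhd_one U \<longrightarrow>
        (\<lambda>n. MAX k\<in>{1..K n}. measure (M n) {\<omega> \<in> space (M n). X n k \<omega> \<in> torus - U})
          \<longlonglongrightarrow> 0)"

end

theory Submission
  imports Defs
begin

text \<open>
  A law on the circle is determined by its Fourier coefficients, by the Stone--Weierstrass theorem, and
  pointwise convergence of Fourier coefficients is equivalent to weak convergence. So it suffices to
  follow \<open>\<Prod>\<^sub>k E (X\<^sub>k powi l)\<close> along the rows. With \<open>m\<^sub>k\<close> the mean of \<open>h (arg X\<^sub>k)\<close>, the factors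
  \<open>exp (\<i> l m\<^sub>k)\<close> are split off; their product is governed by (ii). The remaining factors \<open>1 + w\<^sub>k\<close>
  satisfy \<open>w\<^sub>k = E R\<^sub>k - l\<^sup>2 / 2 * Var h (arg X\<^sub>k)\<close>, where the remainder \<open>R\<^sub>k\<close> is of third order in
  \<open>h (arg X\<^sub>k) - m\<^sub>k\<close> near the identity. Near the identity it is therefore controlled by (iii), away
  from it by (iv), so \<open>\<Sum>\<^sub>k w\<^sub>k\<close> converges. As \<open>max\<^sub>k \<bar>w\<^sub>k\<bar> \<rightarrow> 0\<close>, \<open>\<Sum>\<^sub>k \<bar>w\<^sub>k\<bar>\<close> stays bounded, and both
  \<open>1 + w\<^sub>k\<close> and \<open>exp w\<^sub>k\<close> lie in the unit disc, \<open>\<Prod>\<^sub>k (1 + w\<^sub>k)\<close> has the same limit as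
  \<open>exp (\<Sum>\<^sub>k w\<^sub>k)\<close>.

  The Gaussian law is a wrapped normal law. The generalised Poisson law is a limit of compound Poisson
  laws, which in turn are limits of convolution powers of mixtures with the point mass at the identity.
\<close>

section \<open>Fourier coefficients of laws on the circle\<close>

text \<open>On the circle \<open>h\<close> composed with \<open>arg\<close> is
  \<open>arcsin (Im y)\<close>: the outer branches of \<open>h\<close> remove the jump of
  \<open>arg\<close> at \<open>-1\<close>, so the moments in (ii) and (iii) are integrals of
  continuous functions.

  The obstacle to following \<open>\<Sum>\<^sub>k w\<^sub>k\<close> is that (iv) tests the whole
  array with one function, while \<open>R\<^sub>k\<close> depends on the mean
  \<open>m\<^sub>k\<close>. A cutoff at scale \<open>d\<close> separates two regimes. Away from the
  identity \<open>R\<^sub>k\<close> is exchanged for the uncentred remainder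
  \<open>centred_remainder l 0\<close>, at a cost of order \<open>\<bar>m\<^sub>k\<bar>\<close> that
  infinitesimality makes uniformly small. Near the identity the third-order bound is of order
  \<open>d + \<bar>m\<^sub>k\<bar>\<close> times the variance. Letting \<open>n\<close> grow first
  and shrinking \<open>d\<close> afterwards leaves the integral of the uncentred remainder against
  \<eta>.

  The limiting exponent is this integral minus
  \<open>l\<^sup>2 / 2 * (b + \<integral>h\<^sup>2)\<close>. The share
  \<open>\<integral>h\<^sup>2\<close> completes the integral to the exponent of the generalised
  Poisson law, and \<open>b\<close> is left for the Gaussian factor.\<close>

definition torus_ft :: "complex measure \<Rightarrow> int \<Rightarrow> complex" where
  "torus_ft \<mu> l = (\<integral>y. y powi l \<partial>\<mu>)"

lemma space_torus_borel [simp]: "space torus_borel = torus"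
  by (simp add: torus_borel_def space_restrict_space)

lemma measurable_torus_borel_continuous:
  fixes f :: "complex \<Rightarrow> 'b::topological_space"
  assumes "continuous_on torus f"
  shows "f \<in> borel_measurable torus_borel"
  unfolding torus_borel_def by (rule borel_measurable_continuous_on_restrict[OF assms])

lemma measurable_torus_continuous:
  fixes f :: "complex \<Rightarrow> 'b::topological_space"
  assumes "sets \<mu> = sets torus_borel" "continuous_on torus f"
  shows "f \<in> borel_measurable \<mu>"
  using measurable_torus_borel_continuous[OF assms(2)]
  by (simp cong: measurable_cong_sets add: assms(1))

lemma space_eq_torus: "sets \<mu> = sets torus_borel \<Longrightarrow> space \<mu> = torus"
  using sets_eq_imp_space_eq space_torus_borel by metis

lemma torus_prob_space: "torus_prob \<mu> \<Longrightarrow> prob_space \<mu>"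
  and torus_prob_sets: "torus_prob \<mu> \<Longrightarrow> sets \<mu> = sets torus_borel"
  and torus_prob_in_space: "torus_prob \<mu> \<Longrightarrow> space \<mu> = torus"
  by (auto simp: torus_prob_def space_eq_torus)

lemma torus_bounded:
  fixes f :: "complex \<Rightarrow> 'b::real_normed_vector"
  assumes "continuous_on torus f"
  obtains B where "\<And>y. y \<in> torus \<Longrightarrow> norm (f y) \<le> B"
proof -
  have "bounded (f ` torus)"
    using assms compact_continuous_image compact_sphere compact_imp_bounded by blast
  then obtain B where "\<forall>x\<in>f ` torus. norm x \<le> B" unfolding bounded_iff by blast
  then show ?thesis using that by blast
qed

lemma torus_prob_integrable:
  fixes f :: "complex \<Rightarrow> 'b::{banach, second_countable_topology}"
  assumes \<mu>: "torus_prob \<mu>" and f: "continuous_on torus f"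
  shows "integrable \<mu> f"
proof -
  interpret prob_space \<mu> using \<mu> by (rule torus_prob_space)
  obtain B where B: "\<And>y. y \<in> torus \<Longrightarrow> norm (f y) \<le> B" using torus_bounded[OF f] by blast
  show ?thesis
  proof (rule integrable_const_bound)
    show "AE y in \<mu>. norm (f y) \<le> B"
      using B by (intro AE_I2) (simp add: torus_prob_in_space[OF \<mu>])
    show "f \<in> borel_measurable \<mu>"
      using measurable_torus_continuous[OF torus_prob_sets[OF \<mu>] f] .
  qed
qed

section \<open>Trigonometric polynomials on the circle\<close>

lemma torus_nonzero: "y \<in> torus \<Longrightarrow> y \<noteq> 0"
  by auto

lemma continuous_on_torus_powi: "continuous_on torus (\<lambda>y. y powi l)"
  by (intro continuous_intros) auto

lemma norm_torus_powi: "y \<in> torus \<Longrightarrow> norm (y powi l) = 1"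
  by (simp add: norm_power_int)

text \<open>Laurent polynomials up to equality on \<open>torus\<close>: only there is
  \<open>cnj y\<close> the inverse of \<open>y\<close>, which makes it a Laurent monomial.\<close>

inductive laurent_on_torus :: "(complex \<Rightarrow> complex) \<Rightarrow> bool" where
  monomial: "(\<And>y. y \<in> torus \<Longrightarrow> f y = c * y powi l) \<Longrightarrow> laurent_on_torus f"
| add: "laurent_on_torus f \<Longrightarrow> laurent_on_torus g \<Longrightarrow> (\<And>y. y \<in> torus \<Longrightarrow> h y = f y + g y) \<Longrightarrow>
    laurent_on_torus h"

lemma laurent_on_torus_mult:
  assumes "laurent_on_torus f" "laurent_on_torus g"
  shows "laurent_on_torus (\<lambda>y. f y * g y)"
  using assms
proof (induction f rule: laurent_on_torus.induct)
  case (monomial f c l)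
  from monomial.prems monomial.hyps show ?case
  proof (induction g rule: laurent_on_torus.induct)
    case (monomial g d k)
    have "f y * g y = (c * d) * y powi (l + k)" if "y \<in> torus" for y
      using that monomial torus_nonzero[OF that] by (simp add: power_int_add)
    then show ?case by (rule laurent_on_torus.monomial)
  next
    case (add g1 g2 h)
    then have "laurent_on_torus (\<lambda>y. f y * g1 y)" "laurent_on_torus (\<lambda>y. f y * g2 y)" by auto
    then show ?case by (rule laurent_on_torus.add) (simp add: add algebra_simps)
  qed
next
  case (add f1 f2 h)
  then have "laurent_on_torus (\<lambda>y. f1 y * g y)" "laurent_on_torus (\<lambda>y. f2 y * g y)" by auto
  then show ?case by (rule laurent_on_torus.add) (simp add: add algebra_simps)
qed

lemma laurent_on_torus_real_polynomial:
  assumes "real_polynomial_function g"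
  shows "laurent_on_torus (\<lambda>y. of_real (g y))"
  using assms
proof (induction rule: real_polynomial_function.induct)
  case (linear f)
  interpret bounded_linear f by fact
  have f: "f y = Re y * f 1 + Im y * f \<i>" for y
  proof -
    have "y = Re y *\<^sub>R 1 + Im y *\<^sub>R \<i>" by (simp add: complex_eq_iff)
    then have "f y = f (Re y *\<^sub>R 1 + Im y *\<^sub>R \<i>)" by simp
    then show ?thesis by (simp only: add scaleR real_scaleR_def)
  qed
  \<comment> \<open>From \<open>Re y = (y + cnj y) / 2\<close> and
    \<open>Im y = (y - cnj y) / (2 * \<i>)\<close>.\<close>
  define c d where "c = complex_of_real (f 1) / 2" and "d = complex_of_real (f \<i>) / (2 * \<i>)"
  have eq: "of_real (f y) = (c + d) * y powi 1 + (c - d) * y powi (-1)" if "y \<in> torus" for y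
  proof -
    have inv: "y powi (-1) = cnj y"
      using that by (simp add: power_int_minus inverse_complex_def complex_eq_iff cmod_def)
    have "of_real (f y) = (c + d) * y + (c - d) * cnj y"
      by (subst f) (simp add: c_def d_def complex_eq_iff field_simps)
    then show ?thesis unfolding inv by simp
  qed
  show ?case
    by (rule laurent_on_torus.add[OF laurent_on_torus.monomial[OF refl]
          laurent_on_torus.monomial[OF refl] eq])
next
  case (const c)
  show ?case by (rule laurent_on_torus.monomial[where c = "of_real c" and l = 0]) simp
next
  case (add f g)
  from add.IH show ?case by (rule laurent_on_torus.add) simp
next
  case (mult f g)
  from laurent_on_torus_mult[OF mult.IH] show ?case by simp
qed

lemma laurent_on_torus_continuous: "laurent_on_torus f \<Longrightarrow> continuous_on torus f"
proof (induction rule: laurent_on_torus.induct)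
  case (monomial f c l)
  have "continuous_on torus (\<lambda>y. c * y powi l)"
    by (intro continuous_on_mult_left continuous_on_torus_powi)
  then show ?case using monomial by (subst continuous_on_cong[OF refl]) auto
next
  case (add f g h)
  have "continuous_on torus (\<lambda>y. f y + g y)" using add.IH by (intro continuous_intros)
  moreover have "continuous_on torus (\<lambda>y. f y + g y) = continuous_on torus h"
    by (rule continuous_on_cong) (simp_all add: add.hyps)
  ultimately show ?case by simp
qed

lemma torus_integral_cong:
  assumes "sets \<mu> = sets torus_borel" "\<And>y. y \<in> torus \<Longrightarrow> f y = g y"
  shows "(\<integral>y. f y \<partial>\<mu>) = (\<integral>y. g y \<partial>\<mu>)"
  using assms by (intro Bochner_Integration.integral_cong refl) (simp add: space_eq_torus)

lemma tendsto_integral_laurent: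
  assumes \<mu>: "\<And>n. torus_prob (\<mu> n)" and \<nu>: "torus_prob \<nu>"
    and lim: "\<And>l. (\<lambda>n. torus_ft (\<mu> n) l) \<longlonglongrightarrow> torus_ft \<nu> l"
    and f: "laurent_on_torus f"
  shows "(\<lambda>n. \<integral>y. f y \<partial>\<mu> n) \<longlonglongrightarrow> (\<integral>y. f y \<partial>\<nu>)"
  using f
proof (induction rule: laurent_on_torus.induct)
  case (monomial f c l)
  have eq: "(\<integral>y. f y \<partial>\<rho>) = c * torus_ft \<rho> l" if \<rho>: "torus_prob \<rho>" for \<rho>
    unfolding torus_ft_def
    by (subst torus_integral_cong[OF torus_prob_sets[OF \<rho>] monomial])
       (auto intro!: integral_mult_right torus_prob_integrable \<rho> continuous_on_torus_powi)
  show ?case unfolding eq[OF \<mu>] eq[OF \<nu>] by (intro tendsto_intros lim)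
next
  case (add f g h)
  have eq: "(\<integral>y. h y \<partial>\<rho>) = (\<integral>y. f y \<partial>\<rho>) + (\<integral>y. g y \<partial>\<rho>)" if \<rho>: "torus_prob \<rho>" for \<rho>
    by (subst torus_integral_cong[OF torus_prob_sets[OF \<rho>] add.hyps(3)])
       (auto intro!: Bochner_Integration.integral_add torus_prob_integrable \<rho>
          laurent_on_torus_continuous add.hyps)
  show ?case unfolding eq[OF \<mu>] eq[OF \<nu>] by (intro tendsto_add add.IH)
qed

section \<open>Weak convergence and uniqueness from Fourier coefficients\<close>

lemma torus_integral_diff_le:
  fixes f g :: "complex \<Rightarrow> real"
  assumes \<mu>: "torus_prob \<mu>" and f: "continuous_on torus f" and g: "continuous_on torus g"
    and fg: "\<And>y. y \<in> torus \<Longrightarrow> \<bar>f y - g y\<bar> \<le> e"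
  shows "\<bar>(\<integral>y. f y \<partial>\<mu>) - (\<integral>y. g y \<partial>\<mu>)\<bar> \<le> e"
proof -
  interpret prob_space \<mu> using \<mu> by (rule torus_prob_space)
  have i: "integrable \<mu> f" "integrable \<mu> g" using torus_prob_integrable \<mu> f g by auto
  have "\<bar>(\<integral>y. f y \<partial>\<mu>) - (\<integral>y. g y \<partial>\<mu>)\<bar> = \<bar>\<integral>y. f y - g y \<partial>\<mu>\<bar>" using i by simp
  also have "\<dots> \<le> (\<integral>y. \<bar>f y - g y\<bar> \<partial>\<mu>)" by (rule integral_abs_bound)
  also have "\<dots> \<le> (\<integral>y. e \<partial>\<mu>)"
    using i fg by (intro integral_mono) (auto simp: torus_prob_in_space[OF \<mu>])
  also have "\<dots> = e" by (simp add: prob_space)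
  finally show ?thesis .
qed

text \<open>Laws have mass one, so a uniform approximation within \<open>r / 3\<close> moves each
  integral by at most \<open>r / 3\<close>. The approximant is a real polynomial in
  \<open>Re\<close> and \<open>Im\<close>, which on the circle is a trigonometric
  polynomial.\<close>

theorem torus_weak_conv_if_ft_tendsto:
  assumes \<mu>: "\<And>n. torus_prob (\<mu> n)" and \<nu>: "torus_prob \<nu>"
    and lim: "\<And>l. (\<lambda>n. torus_ft (\<mu> n) l) \<longlonglongrightarrow> torus_ft \<nu> l"
  shows "torus_weak_conv \<mu> \<nu>"
  unfolding torus_weak_conv_def
proof (intro allI impI)
  fix f :: "complex \<Rightarrow> real" assume "continuous_on torus f \<and> bounded (f ` torus)"
  then have f: "continuous_on torus f" ..
  show "(\<lambda>n. \<integral>y. f y \<partial>\<mu> n) \<longlonglongrightarrow> (\<integral>y. f y \<partial>\<nu>)"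
  proof (rule LIMSEQ_I)
    fix r :: real assume r: "0 < r"
    obtain g where g: "real_polynomial_function g" and fg: "\<And>y. y \<in> torus \<Longrightarrow> \<bar>f y - g y\<bar> < r / 3"
      using Stone_Weierstrass_real_polynomial_function[OF compact_sphere f, of "r / 3"] r
      by (metis zero_less_divide_iff zero_less_numeral)
    have gc: "continuous_on torus g"
      using g continuous_on_polymonial_function real_polynomial_function_eq by blast
    have "(\<lambda>n. \<integral>y. complex_of_real (g y) \<partial>\<mu> n) \<longlonglongrightarrow> (\<integral>y. of_real (g y) \<partial>\<nu>)"
      by (rule tendsto_integral_laurent[OF \<mu> \<nu> lim laurent_on_torus_real_polynomial[OF g]])
    then have "(\<lambda>n. \<integral>y. g y \<partial>\<mu> n) \<longlonglongrightarrow> (\<integral>y. g y \<partial>\<nu>)"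
      by (simp add: tendsto_of_real_iff)
    then obtain N where N: "\<And>n. n \<ge> N \<Longrightarrow> \<bar>(\<integral>y. g y \<partial>\<mu> n) - (\<integral>y. g y \<partial>\<nu>)\<bar> < r / 3"
      using LIMSEQ_D[of _ _ "r / 3"] r by fastforce
    have close: "\<bar>(\<integral>y. f y \<partial>\<rho>) - (\<integral>y. g y \<partial>\<rho>)\<bar> \<le> r / 3" if "torus_prob \<rho>" for \<rho>
      using fg by (intro torus_integral_diff_le[OF that f gc]) (simp add: less_imp_le)
    have "norm ((\<integral>y. f y \<partial>\<mu> n) - (\<integral>y. f y \<partial>\<nu>)) < r" if "n \<ge> N" for n
      using N[OF that] close[OF \<mu>[of n]] close[OF \<nu>] unfolding real_norm_def by linarith
    then show "\<exists>N. \<forall>n\<ge>N. norm ((\<integral>y. f y \<partial>\<mu> n) - (\<integral>y. f y \<partial>\<nu>)) < r" by blast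
  qed
qed

text \<open>Continuous functions decreasing to the indicator of a closed set; they carry equality of
  integrals over to equality of measures. The distance to the empty set is \<open>0\<close> by
  convention, so for \<open>C = {}\<close> the limit would be \<open>1\<close>.\<close>

lemma tendsto_setdist_cutoff:
  fixes C :: "complex set"
  assumes "closed C" "C \<noteq> {}"
  shows "(\<lambda>j. max 0 (1 - real j * setdist {y} C)) \<longlonglongrightarrow> indicator C y"
proof (cases "y \<in> C")
  case True
  then have "setdist {y} C = 0" by (simp add: setdist_sing_in_set)
  then show ?thesis using True by simp
next
  case False
  have "setdist {y} C \<noteq> 0" using setdist_eq_0_sing_1[of y C] assms False by simp
  then have d: "setdist {y} C > 0" using setdist_pos_le[of "{y}" C] by linarith
  obtain N :: nat where N: "1 / setdist {y} C < real N" using reals_Archimedean2 by blast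
  have "max 0 (1 - real j * setdist {y} C) = 0" if "j \<ge> N" for j
  proof -
    have "1 < real N * setdist {y} C" using N d by (simp add: field_simps)
    also have "\<dots> \<le> real j * setdist {y} C" using that d by (intro mult_right_mono) auto
    finally show ?thesis by simp
  qed
  then have "eventually (\<lambda>j. max 0 (1 - real j * setdist {y} C) = indicator C y) sequentially"
    using False by (auto simp: eventually_sequentially)
  then show ?thesis by (rule tendsto_eventually)
qed

text \<open>Applied to a constant sequence, the convergence theorem makes the integrals of all
  continuous functions agree. Dominated convergence passes to closed sets, an intersection-stable
  generator.\<close>

theorem torus_ft_inject:
  assumes \<mu>: "torus_prob \<mu>" and \<nu>: "torus_prob \<nu>" and eq: "torus_ft \<mu> = torus_ft \<nu>"
  shows "\<mu> = \<nu>"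
proof -
  interpret \<mu>: prob_space \<mu> using \<mu> by (rule torus_prob_space)
  interpret \<nu>: prob_space \<nu> using \<nu> by (rule torus_prob_space)
  have int_eq: "(\<integral>y. f y \<partial>\<mu>) = (\<integral>y. f y \<partial>\<nu>)" if f: "continuous_on torus f" for f :: "complex \<Rightarrow> real"
  proof -
    have "torus_weak_conv (\<lambda>_. \<mu>) \<nu>"
      by (rule torus_weak_conv_if_ft_tendsto[OF \<mu> \<nu>]) (simp add: eq)
    moreover have "bounded (f ` torus)"
      using f compact_continuous_image compact_sphere compact_imp_bounded by blast
    ultimately have "(\<lambda>n::nat. \<integral>y. f y \<partial>\<mu>) \<longlonglongrightarrow> (\<integral>y. f y \<partial>\<nu>)"
      using f by (auto simp: torus_weak_conv_def)
    then show ?thesis by (simp add: LIMSEQ_const_iff)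
  qed
  have id: "(\<lambda>y. y) \<in> borel_measurable \<rho>" if "torus_prob \<rho>" for \<rho> :: "complex measure"
    using measurable_torus_continuous[OF torus_prob_sets[OF that] continuous_on_id] by simp
  have closed_eq: "measure \<mu> (C \<inter> torus) = measure \<nu> (C \<inter> torus)" if C: "closed C" for C :: "complex set"
  proof (cases "C = {}")
    case False
    have lim: "(\<lambda>j. \<integral>y. max 0 (1 - real j * setdist {y} C) \<partial>\<rho>) \<longlonglongrightarrow> measure \<rho> (C \<inter> torus)"
      if \<rho>: "torus_prob \<rho>" for \<rho>
    proof -
      interpret prob_space \<rho> using \<rho> by (rule torus_prob_space)
      have C': "C \<inter> space \<rho> \<in> sets \<rho>"
        using measurable_sets[OF id[OF \<rho>], of C] C by (simp add: borel_closed Int_commute vimage_def)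
      have "(\<lambda>j. \<integral>y. max 0 (1 - real j * setdist {y} C) \<partial>\<rho>) \<longlonglongrightarrow> (\<integral>y. indicator C y \<partial>\<rho>)"
      proof (rule integral_dominated_convergence[where w = "\<lambda>_. 1"])
        show "indicat_real C \<in> borel_measurable \<rho>"
          by (subst borel_measurable_indicator_iff) (use C' in \<open>simp add: Int_commute\<close>)
        show "(\<lambda>y. max 0 (1 - real j * setdist {y} C)) \<in> borel_measurable \<rho>" for j
          by (intro measurable_torus_continuous torus_prob_sets \<rho>) (auto intro!: continuous_intros)
        show "AE y in \<rho>. norm (max 0 (1 - real j * setdist {y} C)) \<le> 1" for j
          by (intro AE_I2) (auto simp: setdist_pos_le)
      qed (use tendsto_setdist_cutoff[OF C False] in auto)
      also have "(\<integral>y. indicator C y \<partial>\<rho>) = measure \<rho> (C \<inter> torus)"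
        by (simp add: torus_prob_in_space[OF \<rho>])
      finally show ?thesis .
    qed
    have "(\<lambda>j. \<integral>y. max 0 (1 - real j * setdist {y} C) \<partial>\<mu>) = (\<lambda>j. \<integral>y. max 0 (1 - real j * setdist {y} C) \<partial>\<nu>)"
      by (intro ext int_eq) (auto intro!: continuous_intros)
    with lim[OF \<mu>] lim[OF \<nu>] show ?thesis using LIMSEQ_unique by metis
  qed simp
  \<comment> \<open>Closed sets generate the Borel sets of the whole plane, so both laws are first
    pushed forward from the trace \<sigma>-algebra.\<close>
  have "distr \<mu> borel (\<lambda>y. y) = distr \<nu> borel (\<lambda>y. y)"
  proof (rule measure_eqI_generator_eq[where E = "Collect closed" and \<Omega> = UNIV and A = "\<lambda>_. UNIV"])
    show "Int_stable (Collect closed)" by (auto simp: Int_stable_def)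
    fix C :: "complex set" assume "C \<in> Collect closed"
    then have C: "closed C" by simp
    then have e: "emeasure (distr \<rho> borel (\<lambda>y. y)) C = emeasure \<rho> (C \<inter> torus)" if "torus_prob \<rho>" for \<rho>
      by (subst emeasure_distr[OF id[OF that]]) (auto simp: torus_prob_in_space[OF that] vimage_def)
    show "emeasure (distr \<mu> borel (\<lambda>y. y)) C = emeasure (distr \<nu> borel (\<lambda>y. y)) C"
      using closed_eq[OF C] unfolding e[OF \<mu>] e[OF \<nu>]
      by (simp add: \<mu>.emeasure_eq_measure \<nu>.emeasure_eq_measure)
  next
    show "emeasure (distr \<mu> borel (\<lambda>y. y)) UNIV \<noteq> \<infinity>" for i :: nat
      by (subst emeasure_distr[OF id[OF \<mu>]]) auto
  qed (auto simp: borel_eq_closed)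
  note d = this
  show ?thesis
  proof (rule measure_eqI)
    show "sets \<mu> = sets \<nu>" using torus_prob_sets[OF \<mu>] torus_prob_sets[OF \<nu>] by simp
    fix A assume "A \<in> sets \<mu>"
    then obtain B where B: "B \<in> sets borel" "A = torus \<inter> B"
      unfolding torus_prob_sets[OF \<mu>] torus_borel_def sets_restrict_space by auto
    have "emeasure (distr \<rho> borel (\<lambda>y. y)) B = emeasure \<rho> A" if "torus_prob \<rho>" for \<rho>
      by (subst emeasure_distr[OF id[OF that]])
         (use B in \<open>auto simp: torus_prob_in_space[OF that] vimage_def Int_commute\<close>)
    with d \<mu> \<nu> show "emeasure \<mu> A = emeasure \<nu> A" by metis
  qed
qed

section \<open>Limits, convolutions and Gaussian laws\<close>

lemma torus_arg_bounds: "y \<in> torus \<Longrightarrow> - pi \<le> torus_arg y \<and> torus_arg y < pi"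
  using Arg_bounded[of y] by (auto simp: torus_arg_def)

lemma cis_torus_arg: "y \<in> torus \<Longrightarrow> cis (torus_arg y) = y"
proof -
  assume y: "y \<in> torus"
  then have c: "cis (Arg y) = y"
    using cis_Arg[OF torus_nonzero[OF y]] by (simp add: sgn_div_norm)
  have "cis (- pi) = cis pi" by (simp add: complex_eq_iff)
  then show ?thesis using c by (auto simp: torus_arg_def)
qed

lemma Re_torus: "y \<in> torus \<Longrightarrow> Re y = cos (torus_arg y)"
  and Im_torus: "y \<in> torus \<Longrightarrow> Im y = sin (torus_arg y)"
  using cis_torus_arg[of y] by (metis cis.sel(1), metis cis.sel(2))

text \<open>A closed form that makes measurability evident although \<open>torus_arg\<close> jumps
  at \<open>-1\<close>. The clause \<open>Re y = - 1\<close> serves that point: there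
  \<open>Im y = 0\<close> and \<open>arccos\<close> yields \<open>pi\<close>, while the argument is
  \<open>- pi\<close>.\<close>

lemma torus_arg_eq_arccos:
  assumes "y \<in> torus"
  shows "torus_arg y = (if Im y < 0 \<or> Re y = - 1 then - arccos (Re y) else arccos (Re y))"
proof -
  define \<theta> where "\<theta> = torus_arg y"
  have \<theta>: "- pi \<le> \<theta>" "\<theta> < pi" using torus_arg_bounds[OF assms] by (auto simp: \<theta>_def)
  have y: "Re y = cos \<theta>" "Im y = sin \<theta>" using Re_torus Im_torus assms by (auto simp: \<theta>_def)
  consider "\<theta> = - pi" | "- pi < \<theta>" "\<theta> < 0" | "0 \<le> \<theta>" by (cases "\<theta> = - pi") (use \<theta> in linarith)+
  then have "\<theta> = (if Im y < 0 \<or> Re y = - 1 then - arccos (Re y) else arccos (Re y))"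
  proof cases
    case 1 then show ?thesis by (simp add: y)
  next
    case 2
    have "sin (- \<theta>) > 0" using 2 by (intro sin_gt_zero) auto
    moreover have "arccos (cos (- \<theta>)) = - \<theta>" using 2 by (intro arccos_cos) auto
    ultimately show ?thesis by (simp add: y)
  next
    case 3
    have s: "sin \<theta> \<ge> 0" using 3 \<theta> by (intro sin_ge_zero) auto
    have a: "arccos (cos \<theta>) = \<theta>" using 3 \<theta> by (intro arccos_cos) auto
    have "cos \<theta> \<noteq> - 1" using a \<theta> by auto
    then show ?thesis using s a by (simp add: y)
  qed
  then show ?thesis by (simp add: \<theta>_def)
qed

lemma torus_arg_measurable: "torus_arg \<in> borel_measurable torus_borel"
proof -
  have "(\<lambda>y. arccos (Re y)) \<in> borel_measurable torus_borel"
  proof (intro measurable_torus_borel_continuous continuous_on_arccos continuous_intros ballI)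
    fix y :: complex assume "y \<in> torus"
    then show "- 1 \<le> Re y \<and> Re y \<le> 1" using abs_Re_le_cmod[of y] by auto
  qed
  moreover have "Re \<in> borel_measurable torus_borel" "Im \<in> borel_measurable torus_borel"
    by (auto intro!: measurable_torus_borel_continuous continuous_intros)
  ultimately have "(\<lambda>y. if Im y < 0 \<or> Re y = - 1 then - arccos (Re y) else arccos (Re y))
      \<in> borel_measurable torus_borel"
    by measurable
  then show ?thesis
    by (subst measurable_cong[OF torus_arg_eq_arccos]) auto
qed

text \<open>The outer branches of \<open>trunc_h\<close> reflect the angle into
  \<open>[-pi/2, pi/2]\<close> without changing its sine. Hence the truncated argument is continuous
  on the whole circle, even across \<open>-1\<close>.\<close>

lemma trunc_h_torus_arg:
  assumes "y \<in> torus"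
  shows "trunc_h (torus_arg y) = arcsin (Im y)"
proof -
  define \<theta> where "\<theta> = torus_arg y"
  have \<theta>: "- pi \<le> \<theta>" "\<theta> < pi" using torus_arg_bounds[OF assms] by (auto simp: \<theta>_def)
  consider "\<theta> < - pi / 2" | "- pi / 2 \<le> \<theta>" "\<theta> < pi / 2" | "pi / 2 \<le> \<theta>" by linarith
  then have "trunc_h \<theta> = arcsin (sin \<theta>)"
  proof cases
    case 1
    have "sin \<theta> = sin (- \<theta> - pi)" by (simp add: sin_diff)
    moreover have "arcsin (sin (- \<theta> - pi)) = - \<theta> - pi" using 1 \<theta> by (intro arcsin_sin) auto
    ultimately show ?thesis using 1 \<theta> by (simp add: trunc_h_def)
  next
    case 2
    then have "arcsin (sin \<theta>) = \<theta>" by (intro arcsin_sin) auto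
    then show ?thesis using 2 \<theta> by (simp add: trunc_h_def)
  next
    case 3
    have "sin \<theta> = sin (pi - \<theta>)" by simp
    moreover have "arcsin (sin (pi - \<theta>)) = pi - \<theta>" using 3 \<theta> by (intro arcsin_sin) auto
    ultimately show ?thesis using 3 \<theta> by (simp add: trunc_h_def)
  qed
  then show ?thesis using Im_torus[OF assms] by (simp add: \<theta>_def)
qed

section \<open>Transforms of laws and their closure properties\<close>

lemma torus_prob_distr:
  assumes "prob_space N" "f \<in> measurable N torus_borel"
  shows "torus_prob (distr N torus_borel f)"
  using assms by (simp add: torus_prob_def prob_space.prob_space_distr)

lemma torus_ft_distr:
  assumes "f \<in> measurable N torus_borel"
  shows "torus_ft (distr N torus_borel f) l = (\<integral>x. f x powi l \<partial>N)"
  unfolding torus_ft_def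
  by (rule integral_distr[OF assms measurable_torus_borel_continuous[OF continuous_on_torus_powi]])

lemma measurable_into_torus_borel:
  assumes "f \<in> borel_measurable N" "\<And>x. x \<in> space N \<Longrightarrow> f x \<in> torus"
  shows "f \<in> measurable N torus_borel"
  unfolding torus_borel_def using assms by (intro measurable_restrict_space2) auto

lemma measurable_into_borel:
  assumes "f \<in> measurable N torus_borel"
  shows "f \<in> borel_measurable N"
  using assms unfolding torus_borel_def by (rule measurable_restrict_space2_iff[THEN iffD1, THEN conjunct1])

lemma norm_torus_ft_le_1: "torus_prob \<mu> \<Longrightarrow> norm (torus_ft \<mu> l) \<le> 1"
proof -
  assume \<mu>: "torus_prob \<mu>"
  then interpret prob_space \<mu> by (rule torus_prob_space)
  have "norm (torus_ft \<mu> l) \<le> (\<integral>y. norm (y powi l) \<partial>\<mu>)"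
    unfolding torus_ft_def by (rule integral_norm_bound)
  also have "\<dots> = (\<integral>y. 1 \<partial>\<mu>)"
    by (intro torus_integral_cong torus_prob_sets \<mu> norm_torus_powi)
  finally show ?thesis by (simp add: prob_space)
qed

text \<open>Membership is the existence that the definite descriptions of the limit laws presuppose.
  Closure under products, mixtures with the constant \<open>1\<close> and pointwise limits leads
  from simple laws to generalised Poisson ones.\<close>

definition is_torus_ft :: "(int \<Rightarrow> complex) \<Rightarrow> bool" where
  "is_torus_ft \<phi> \<longleftrightarrow> (\<exists>\<mu>. torus_prob \<mu> \<and> (\<forall>l. torus_ft \<mu> l = \<phi> l))"

lemma is_torus_ft_The:
  assumes "is_torus_ft \<phi>"
  defines "\<mu> \<equiv> (THE \<mu>. torus_prob \<mu> \<and> (\<forall>l. (\<integral>y. y powi l \<partial>\<mu>) = \<phi> l))"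
  shows "torus_prob \<mu>" "torus_ft \<mu> l = \<phi> l"
proof -
  have "\<exists>!\<mu>. torus_prob \<mu> \<and> (\<forall>l. (\<integral>y. y powi l \<partial>\<mu>) = \<phi> l)"
    using assms torus_ft_inject unfolding is_torus_ft_def torus_ft_def fun_eq_iff by metis
  from theI'[OF this] show "torus_prob \<mu>" "torus_ft \<mu> l = \<phi> l"
    unfolding \<mu>_def torus_ft_def by auto
qed

text \<open>Unwrapping the circle to \<open>[-\<pi>, \<pi>)\<close> makes every sequence of laws tight on the line, so that
  Helly's selection theorem supplies the limit law.\<close>

theorem is_torus_ft_limit:
  assumes \<phi>: "\<And>n. is_torus_ft (\<phi> n)" and lim: "\<And>l. (\<lambda>n. \<phi> n l) \<longlonglongrightarrow> \<psi> l"
  shows "is_torus_ft \<psi>"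
proof -
  obtain \<mu> where \<mu>: "\<And>n. torus_prob (\<mu> n)" and ft: "\<And>n l. torus_ft (\<mu> n) l = \<phi> n l"
    using \<phi> unfolding is_torus_ft_def by metis
  have arg: "torus_arg \<in> borel_measurable (\<mu> n)" for n
    using torus_arg_measurable by (simp cong: measurable_cong_sets add: torus_prob_sets[OF \<mu>])
  define \<nu> where "\<nu> n = distr (\<mu> n) borel torus_arg" for n
  have rd: "real_distribution (\<nu> n)" for n
    unfolding \<nu>_def using torus_prob_space[OF \<mu>] arg by (rule prob_space.real_distribution_distr)
  have "tight \<nu>"
    unfolding tight_def
  proof (intro conjI allI impI)
    fix e :: real assume e: "e > 0"
    have "measure (\<nu> n) {- 4<..4} = 1" for n
    proof -
      interpret prob_space "\<mu> n" using \<mu> by (rule torus_prob_space)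
      have "torus_arg -` {- 4<..4} \<inter> space (\<mu> n) = space (\<mu> n)"
        using torus_arg_bounds pi_less_4 by (fastforce simp: torus_prob_in_space[OF \<mu>])
      then show ?thesis unfolding \<nu>_def by (subst measure_distr[OF arg]) (auto simp: prob_space)
    qed
    then show "\<exists>a b. a < b \<and> (\<forall>n. 1 - e < measure (\<nu> n) {a<..b})"
      using e by (intro exI[of _ "-4"] exI[of _ 4]) auto
  qed (rule rd)
  from tight_imp_convergent_subsubsequence[OF this strict_mono_id]
  obtain r N where r: "strict_mono (r :: nat \<Rightarrow> nat)" and N: "real_distribution N"
    and wc: "weak_conv_m (\<lambda>n. \<nu> (r n)) N"
    by (auto simp: comp_def)
  interpret N: real_distribution N by fact
  have "continuous_on UNIV cis" by (intro continuous_intros)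
  then have "cis \<in> borel_measurable borel" by (rule borel_measurable_continuous_onI)
  then have "cis \<in> borel_measurable N" by (simp cong: measurable_cong_sets)
  then have cis: "cis \<in> measurable N torus_borel"
    by (rule measurable_into_torus_borel) simp
  \<comment> \<open>Mass may move to \<open>pi\<close>, outside the range of
    \<open>torus_arg\<close>. Wrapping the limit with \<open>cis\<close> identifies
    \<open>pi\<close> with \<open>- pi\<close>, and \<open>cis (l * x)\<close> does not distinguish
    them because \<open>l\<close> is an integer.\<close>
  have "torus_ft (distr N torus_borel cis) l = \<psi> l" for l
  proof -
    have "(\<lambda>n. \<integral>x. cis (l * x) \<partial>\<nu> (r n)) \<longlonglongrightarrow> (\<integral>x. cis (l * x) \<partial>N)"
      using rd by (intro weak_conv_imp_integral_bdd_continuous_conv[where B = 1] wc)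
        (auto intro!: continuous_intros N simp: cis_conv_exp)
    moreover have "(\<integral>x. cis (l * x) \<partial>\<nu> n) = \<phi> n l" for n
    proof -
      have "(\<integral>x. cis (l * x) \<partial>\<nu> n) = (\<integral>y. cis (l * torus_arg y) \<partial>\<mu> n)"
        unfolding \<nu>_def
        by (rule integral_distr[OF arg]) (auto intro!: borel_measurable_continuous_onI continuous_intros)
      also have "\<dots> = torus_ft (\<mu> n) l"
        unfolding torus_ft_def
      proof (rule torus_integral_cong[OF torus_prob_sets[OF \<mu>]])
        fix y :: complex assume "y \<in> torus"
        then show "cis (l * torus_arg y) = y powi l"
          using cis_power_int[of "torus_arg y" l] cis_torus_arg by simp
      qed
      finally show ?thesis by (simp add: ft)
    qed
    ultimately have "(\<lambda>n. \<phi> (r n) l) \<longlonglongrightarrow> (\<integral>x. cis (l * x) \<partial>N)" by simp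
    moreover have "(\<lambda>n. \<phi> (r n) l) \<longlonglongrightarrow> \<psi> l"
      using LIMSEQ_subseq_LIMSEQ[OF lim r] by (simp add: comp_def)
    ultimately have "(\<integral>x. cis (l * x) \<partial>N) = \<psi> l" by (rule LIMSEQ_unique)
    then show ?thesis by (simp add: torus_ft_distr[OF cis] cis_power_int)
  qed
  moreover have "torus_prob (distr N torus_borel cis)"
    by (rule torus_prob_distr[OF N.prob_space_axioms cis])
  ultimately show ?thesis unfolding is_torus_ft_def by blast
qed

lemma measurable_times_torus:
  assumes \<mu>: "sets \<mu> = sets torus_borel" and \<nu>: "sets \<nu> = sets torus_borel"
  shows "(\<lambda>(x, y). x * y) \<in> measurable (\<mu> \<Otimes>\<^sub>M \<nu>) torus_borel"
proof (rule measurable_into_torus_borel)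
  have [measurable]: "(\<lambda>y. y) \<in> borel_measurable \<mu>" "(\<lambda>y. y) \<in> borel_measurable \<nu>"
    using measurable_torus_continuous[OF _ continuous_on_id] \<mu> \<nu> by auto
  have "fst \<in> borel_measurable (\<mu> \<Otimes>\<^sub>M \<nu>)" "snd \<in> borel_measurable (\<mu> \<Otimes>\<^sub>M \<nu>)"
    using measurable_compose[OF measurable_fst[of \<mu> \<nu>], of "\<lambda>y. y" borel]
      measurable_compose[OF measurable_snd[of \<mu> \<nu>], of "\<lambda>y. y" borel] by measurable
  then show "(\<lambda>(x, y). x * y) \<in> borel_measurable (\<mu> \<Otimes>\<^sub>M \<nu>)"
    unfolding case_prod_beta by measurable
  fix p assume "p \<in> space (\<mu> \<Otimes>\<^sub>M \<nu>)"
  then show "(case p of (x, y) \<Rightarrow> x * y) \<in> torus"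
    using space_eq_torus[OF \<mu>] space_eq_torus[OF \<nu>]
    by (auto simp: space_pair_measure norm_mult)
qed

lemma torus_prob_convolution:
  assumes \<mu>: "torus_prob \<mu>" and \<nu>: "torus_prob \<nu>"
  shows "torus_prob (torus_convolution \<mu> \<nu>)"
    and "torus_ft (torus_convolution \<mu> \<nu>) l = torus_ft \<mu> l * torus_ft \<nu> l"
proof -
  interpret \<mu>: prob_space \<mu> using \<mu> by (rule torus_prob_space)
  interpret \<nu>: prob_space \<nu> using \<nu> by (rule torus_prob_space)
  interpret P: pair_prob_space \<mu> \<nu> ..
  note meas = measurable_times_torus[OF torus_prob_sets[OF \<mu>] torus_prob_sets[OF \<nu>]]
  show "torus_prob (torus_convolution \<mu> \<nu>)"
    unfolding torus_convolution_def by (rule torus_prob_distr[OF P.prob_space_axioms meas])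
  have "(\<lambda>p. (case p of (x, y) \<Rightarrow> x * y) powi l) \<in> borel_measurable (\<mu> \<Otimes>\<^sub>M \<nu>)"
    using measurable_compose[OF meas measurable_torus_borel_continuous[OF continuous_on_torus_powi]] .
  then have "integrable (\<mu> \<Otimes>\<^sub>M \<nu>) (\<lambda>p. (case p of (x, y) \<Rightarrow> x * y) powi l)"
    by (intro P.integrable_const_bound[where B = 1] AE_I2)
       (auto simp: space_pair_measure norm_power_int norm_mult torus_prob_in_space[OF \<mu>] torus_prob_in_space[OF \<nu>])
  then have int: "integrable (\<mu> \<Otimes>\<^sub>M \<nu>) (\<lambda>(x, y). x powi l * y powi l)"
    by (simp add: case_prod_unfold power_int_mult_distrib)
  have "torus_ft (torus_convolution \<mu> \<nu>) l = (\<integral>p. (case p of (x, y) \<Rightarrow> x * y) powi l \<partial>(\<mu> \<Otimes>\<^sub>M \<nu>))"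
    unfolding torus_convolution_def by (rule torus_ft_distr[OF meas])
  also have "\<dots> = (\<integral>(x, y). x powi l * y powi l \<partial>(\<mu> \<Otimes>\<^sub>M \<nu>))"
    by (simp add: case_prod_unfold power_int_mult_distrib)
  also have "\<dots> = (\<integral>x. (\<integral>y. x powi l * y powi l \<partial>\<nu>) \<partial>\<mu>)"
    by (rule P.integral_fst[OF int, symmetric])
  also have "\<dots> = torus_ft \<mu> l * torus_ft \<nu> l"
    by (simp add: torus_ft_def)
  finally show "torus_ft (torus_convolution \<mu> \<nu>) l = torus_ft \<mu> l * torus_ft \<nu> l" .
qed

lemma torus_prob_return: "z \<in> torus \<Longrightarrow> torus_prob (return torus_borel z)"
  and torus_ft_return: "z \<in> torus \<Longrightarrow> torus_ft (return torus_borel z) l = z powi l"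
proof -
  assume z: "z \<in> torus"
  then show "torus_prob (return torus_borel z)"
    by (simp add: torus_prob_def prob_space_return)
  show "torus_ft (return torus_borel z) l = z powi l"
    unfolding torus_ft_def using z
    by (intro integral_return measurable_torus_borel_continuous continuous_on_torus_powi) simp_all
qed

lemma is_torus_ft_powi: "z \<in> torus \<Longrightarrow> is_torus_ft (\<lambda>l. z powi l)"
  unfolding is_torus_ft_def using torus_prob_return torus_ft_return by blast

lemma is_torus_ft_mult: "is_torus_ft \<phi> \<Longrightarrow> is_torus_ft \<psi> \<Longrightarrow> is_torus_ft (\<lambda>l. \<phi> l * \<psi> l)"
  unfolding is_torus_ft_def by (metis torus_prob_convolution)

lemma is_torus_ft_power: "is_torus_ft \<phi> \<Longrightarrow> is_torus_ft (\<lambda>l. \<phi> l ^ n)"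
proof (induction n)
  case 0
  show ?case using is_torus_ft_powi[of 1] by simp
next
  case (Suc n)
  then show ?case using is_torus_ft_mult[of \<phi> "\<lambda>l. \<phi> l ^ n"] by simp
qed

text \<open>The mixture of the point mass at \<open>1\<close> (weight \<open>1 - p\<close>) with the
  given law (weight \<open>p\<close>) is realised by letting a Bernoulli coin choose between
  \<open>1\<close> and an independent draw.\<close>

lemma is_torus_ft_mixture:
  assumes "is_torus_ft \<phi>" and p: "0 \<le> p" "p \<le> 1"
  shows "is_torus_ft (\<lambda>l. 1 + of_real p * (\<phi> l - 1))"
proof -
  obtain \<mu> where \<mu>: "torus_prob \<mu>" and ft: "\<And>l. torus_ft \<mu> l = \<phi> l"
    using assms(1) unfolding is_torus_ft_def by metis
  interpret \<mu>: prob_space \<mu> using \<mu> by (rule torus_prob_space)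
  interpret B: prob_space "measure_pmf (bernoulli_pmf p)" by (rule measure_pmf.prob_space_axioms)
  interpret P: pair_prob_space "measure_pmf (bernoulli_pmf p)" \<mu> ..
  let ?P = "measure_pmf (bernoulli_pmf p) \<Otimes>\<^sub>M \<mu>"
  define f :: "bool \<times> complex \<Rightarrow> complex" where "f = (\<lambda>(b, y). if b then y else 1)"
  have [measurable]: "(\<lambda>y. y) \<in> borel_measurable \<mu>"
    using measurable_torus_continuous[OF torus_prob_sets[OF \<mu>] continuous_on_id] by auto
  have s: "snd \<in> borel_measurable ?P"
    using measurable_compose[OF measurable_snd[of "measure_pmf (bernoulli_pmf p)" \<mu>], of "\<lambda>y. y" borel]
    by measurable
  have "Measurable.pred ?P fst"
    using measurable_compose[OF measurable_fst[of "measure_pmf (bernoulli_pmf p)" \<mu>], of "\<lambda>b. b" "count_space UNIV"]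
    by simp
  with s have fb: "f \<in> borel_measurable ?P"
    unfolding f_def case_prod_beta by measurable
  have f: "f \<in> measurable ?P torus_borel"
    using fb by (rule measurable_into_torus_borel)
      (auto simp: f_def space_pair_measure torus_prob_in_space[OF \<mu>])
  have int: "integrable ?P (\<lambda>(b, y). f (b, y) powi l)" for l
  proof -
    have "(\<lambda>x. f x powi l) \<in> borel_measurable ?P"
      using measurable_compose[OF f measurable_torus_borel_continuous[OF continuous_on_torus_powi]] .
    then have "integrable ?P (\<lambda>x. f x powi l)"
      by (intro P.integrable_const_bound[where B = 1] AE_I2)
         (auto simp: f_def space_pair_measure norm_power_int torus_prob_in_space[OF \<mu>])
    then show ?thesis by (simp add: case_prod_unfold)
  qed
  have "torus_ft (distr ?P torus_borel f) l = 1 + of_real p * (\<phi> l - 1)" for l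
  proof -
    have "torus_ft (distr ?P torus_borel f) l = (\<integral>(b, y). f (b, y) powi l \<partial>?P)"
      by (simp add: torus_ft_distr[OF f] case_prod_unfold)
    also have "\<dots> = (\<integral>b. (\<integral>y. f (b, y) powi l \<partial>\<mu>) \<partial>measure_pmf (bernoulli_pmf p))"
      by (rule P.integral_fst[OF int, symmetric])
    also have "\<dots> = \<phi> l * p + (1 - p)"
      using p by (subst integral_measure_pmf[of UNIV])
        (auto simp: f_def ft[unfolded torus_ft_def] \<mu>.prob_space UNIV_bool scaleR_conv_of_real)
    finally show ?thesis by (simp add: algebra_simps)
  qed
  then show ?thesis
    unfolding is_torus_ft_def using torus_prob_distr[OF P.prob_space_axioms f] by blast
qed

text \<open>The law of \<open>cis (sqrt b * Z)\<close> for a standard normal \<open>Z\<close>: the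
  \<open>l\<close>-th coefficient is the characteristic function of \<open>Z\<close> at
  \<open>l * sqrt b\<close>.\<close>

lemma gauss_measure_ft:
  assumes b: "b \<ge> 0"
  shows "torus_prob (gauss_measure b)"
    and "torus_ft (gauss_measure b) l = of_real (exp (- b * (of_int l)\<^sup>2 / 2))"
proof -
  let ?N = "std_normal_distribution"
  interpret N: prob_space ?N by (rule real_dist_normal_dist[THEN real_distribution.axioms(1)])
  have meas: "(\<lambda>x. cis (sqrt b * x)) \<in> measurable ?N torus_borel"
    by (rule measurable_into_torus_borel)
       (auto intro!: borel_measurable_continuous_onI continuous_intros)
  have "torus_ft (distr ?N torus_borel (\<lambda>x. cis (sqrt b * x))) l = of_real (exp (- b * (of_int l)\<^sup>2 / 2))" for l
  proof -
    have "torus_ft (distr ?N torus_borel (\<lambda>x. cis (sqrt b * x))) l = (\<integral>x. cis (sqrt b * x) powi l \<partial>?N)"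
      by (rule torus_ft_distr[OF meas])
    also have "\<dots> = char ?N (l * sqrt b)"
      unfolding char_def cis_power_int by (simp only: cis_conv_exp mult.assoc)
    also have "\<dots> = of_real (exp (- b * (of_int l)\<^sup>2 / 2))"
      using b by (simp add: char_std_normal_distribution power_mult_distrib mult.commute)
    finally show ?thesis .
  qed
  then have "is_torus_ft (\<lambda>l. of_real (exp (- b * (of_int l)\<^sup>2 / 2)))"
    unfolding is_torus_ft_def using torus_prob_distr[OF N.prob_space_axioms meas] by blast
  from is_torus_ft_The[OF this]
  show "torus_prob (gauss_measure b)"
    "torus_ft (gauss_measure b) l = of_real (exp (- b * (of_int l)\<^sup>2 / 2))"
    unfolding gauss_measure_def by auto
qed

section \<open>Exponentials of Fourier coefficients\<close>

text \<open>Products of points of the unit disc differ by at most the sum of the differences of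
  their factors. Comparing \<open>1 + w\<close> with \<open>exp w\<close> factor by factor avoids
  complex logarithms.\<close>

lemma tendsto_prod_one_plus_exp:
  fixes w :: "nat \<Rightarrow> 'i \<Rightarrow> complex"
  assumes fin: "\<And>n. finite (I n)"
    and le1: "\<And>n k. k \<in> I n \<Longrightarrow> norm (1 + w n k) \<le> 1"
    and u: "\<And>n k. k \<in> I n \<Longrightarrow> norm (w n k) \<le> u n" "u \<longlonglongrightarrow> 0"
    and B: "\<And>n. (\<Sum>k\<in>I n. norm (w n k)) \<le> B"
    and s: "(\<lambda>n. \<Sum>k\<in>I n. w n k) \<longlonglongrightarrow> s"
  shows "(\<lambda>n. \<Prod>k\<in>I n. (1 + w n k)) \<longlonglongrightarrow> exp s"
proof -
  have B0: "0 \<le> B" using B[of 0] sum_nonneg[of "I 0" "\<lambda>k. norm (w 0 k)"] by auto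
  have diff: "(\<lambda>n. (\<Prod>k\<in>I n. (1 + w n k)) - (\<Prod>k\<in>I n. exp (w n k))) \<longlonglongrightarrow> 0"
  proof (rule LIMSEQ_I)
    fix r :: real assume r: "r > 0"
    \<comment> \<open>Dividing by \<open>B + 1\<close> keeps the quotient defined for
      \<open>B = 0\<close> and makes \<open>e * B < r\<close> strict.\<close>
    define e where "e = r / (B + 1)"
    have e: "e > 0" "e * B < r" using r B0 by (simp_all add: e_def field_simps)
    have "(exp has_derivative (*) 1) (at (0::complex))"
      using DERIV_exp[of "0::complex"] by (simp add: has_field_derivative_def)
    then obtain d where d: "d > 0"
      and exp: "\<And>z::complex. norm z < d \<Longrightarrow> norm (exp z - 1 - z) \<le> e * norm z"
      unfolding has_derivative_at_alt using e by fastforce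
    obtain N where N: "\<And>n. n \<ge> N \<Longrightarrow> \<bar>u n\<bar> < d"
      using LIMSEQ_D[OF u(2) d] by auto
    have "norm ((\<Prod>k\<in>I n. (1 + w n k)) - (\<Prod>k\<in>I n. exp (w n k)) - 0) < r" if n: "n \<ge> N" for n
    proof -
      have "norm ((\<Prod>k\<in>I n. (1 + w n k)) - (\<Prod>k\<in>I n. exp (w n k))) \<le> (\<Sum>k\<in>I n. norm ((1 + w n k) - exp (w n k)))"
      proof (rule norm_prod_diff)
        fix k assume k: "k \<in> I n"
        \<comment> \<open>\<open>exp (w n k)\<close> has modulus \<open>exp (Re (w n k))\<close>, so
          it suffices that \<open>Re (w n k) \<le> 0\<close>.\<close>
        have "1 + Re (w n k) \<le> 1" using le1[OF k] complex_Re_le_cmod[of "1 + w n k"] by simp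
        then show "norm (exp (w n k)) \<le> 1" by simp
      qed (rule le1)
      also have "\<dots> \<le> (\<Sum>k\<in>I n. e * norm (w n k))"
      proof (rule sum_mono)
        fix k assume k: "k \<in> I n"
        have "norm (w n k) < d" using u(1)[OF k] N[OF n] by linarith
        then show "norm ((1 + w n k) - exp (w n k)) \<le> e * norm (w n k)"
          using exp[of "w n k"] by (simp add: norm_minus_commute algebra_simps)
      qed
      also have "\<dots> \<le> e * B" using B[of n] e by (simp add: sum_distrib_left[symmetric])
      finally show ?thesis using e by simp
    qed
    then show "\<exists>N. \<forall>n\<ge>N. norm ((\<Prod>k\<in>I n. (1 + w n k)) - (\<Prod>k\<in>I n. exp (w n k)) - 0) < r" by blast
  qed
  have "(\<lambda>n. \<Prod>k\<in>I n. exp (w n k)) \<longlonglongrightarrow> exp s"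
    using tendsto_exp[OF s] fin by (simp add: exp_sum)
  from tendsto_add[OF diff this] show ?thesis by simp
qed

text \<open>Euler's limit of \<open>(1 + c / n * (\<phi> l - 1)) ^ n\<close>: the base is the
  transform of a mixture, its power that of a convolution power. Starting at some
  \<open>N > c\<close> keeps the mixing weight at most \<open>1\<close>.\<close>

lemma is_torus_ft_exp:
  assumes \<phi>: "is_torus_ft \<phi>" and c: "c \<ge> 0"
  shows "is_torus_ft (\<lambda>l. exp (of_real c * (\<phi> l - 1)))"
proof -
  obtain N :: nat where N: "c < real N" using reals_Archimedean2 by blast
  define p where "p n = c / real (n + N)" for n
  have p: "0 \<le> p n" "p n \<le> 1" for n using N c by (auto simp: p_def divide_simps)
  have mix: "is_torus_ft (\<lambda>l. 1 + of_real (p n) * (\<phi> l - 1))" for n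
    by (rule is_torus_ft_mixture[OF \<phi> p])
  have "(\<lambda>n. (1 + of_real (p n) * (\<phi> l - 1)) ^ (n + N)) \<longlonglongrightarrow> exp (of_real c * (\<phi> l - 1))" for l
  proof -
    have p_lim: "p \<longlonglongrightarrow> 0"
      unfolding p_def by (rule LIMSEQ_ignore_initial_segment[OF lim_const_over_n])
    have pn: "of_nat (n + N) * of_real (p n) = complex_of_real c" for n
    proof -
      have "real (n + N) \<noteq> 0" using N c by auto
      then have "real (n + N) * p n = c" by (simp add: p_def)
      then show ?thesis by (metis of_real_mult of_real_of_nat_eq)
    qed
    have "(\<lambda>n. \<Prod>k\<in>{..<n + N}. (1 + of_real (p n) * (\<phi> l - 1))) \<longlonglongrightarrow> exp (of_real c * (\<phi> l - 1))"
    proof (rule tendsto_prod_one_plus_exp[where u = "\<lambda>n. p n * norm (\<phi> l - 1)" and B = "c * norm (\<phi> l - 1)"])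
      \<comment> \<open>Each factor is itself the transform of a law, hence of modulus at most
        \<open>1\<close>.\<close>
      show "norm (1 + of_real (p n) * (\<phi> l - 1)) \<le> 1" for n
        using mix[of n] norm_torus_ft_le_1 unfolding is_torus_ft_def by metis
      show "norm (of_real (p n) * (\<phi> l - 1)) \<le> p n * norm (\<phi> l - 1)" for n
        using p by (simp add: norm_mult)
      show "(\<lambda>n. p n * norm (\<phi> l - 1)) \<longlonglongrightarrow> 0" using tendsto_mult_left_zero[OF p_lim] .
      have "real (n + N) * p n = c" for n using pn[of n] by (metis of_real_eq_iff of_real_mult of_real_of_nat_eq)
      then show "(\<Sum>k<n + N. norm (of_real (p n) * (\<phi> l - 1))) \<le> c * norm (\<phi> l - 1)" for n
        using p by (simp add: norm_mult mult.assoc[symmetric])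
      show "(\<lambda>n. \<Sum>k<n + N. of_real (p n) * (\<phi> l - 1)) \<longlonglongrightarrow> of_real c * (\<phi> l - 1)"
        using pn by (simp add: mult.assoc[symmetric])
    qed simp
    then show ?thesis by simp
  qed
  with is_torus_ft_power[OF mix] show ?thesis by (rule is_torus_ft_limit)
qed

text \<open>With \<open>c\<close> the total mass, the integral is \<open>c * (\<phi> l - 1)\<close>
  for the transform \<phi> of the normalised measure, so \<open>is_torus_ft_exp\<close> applies. The
  null measure cannot be normalised; it yields the point mass at \<open>1\<close>.\<close>

lemma is_torus_ft_compound_poisson:
  assumes sets: "sets \<eta> = sets torus_borel" and "finite_measure \<eta>"
  shows "is_torus_ft (\<lambda>l. exp (\<integral>y. (y powi l - 1) \<partial>\<eta>))"
proof -
  interpret finite_measure \<eta> by fact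
  define c where "c = measure \<eta> (space \<eta>)"
  have meas: "(\<lambda>y. y powi l) \<in> borel_measurable \<eta>" for l
    by (rule measurable_torus_continuous[OF sets continuous_on_torus_powi])
  have int: "integrable \<eta> (\<lambda>y. y powi l)" for l
    by (rule integrable_const_bound[where B = 1])
       (use meas in \<open>auto simp: space_eq_torus[OF sets] norm_power_int\<close>)
  have eq: "(\<integral>y. (y powi l - 1) \<partial>\<eta>) = (\<integral>y. y powi l \<partial>\<eta>) - of_real c" for l
    using int by (simp add: c_def scaleR_conv_of_real)
  show ?thesis
  proof (cases "c = 0")
    case True
    then have "emeasure \<eta> (space \<eta>) = 0" by (simp add: c_def emeasure_eq_measure)
    then have "AE y in \<eta>. False" by (intro AE_I[of _ _ "space \<eta>"]) auto
    then have "(\<integral>y. (y powi l - 1) \<partial>\<eta>) = (\<integral>y. 0 \<partial>\<eta>)" for l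
      by (intro integral_cong_AE borel_measurable_diff) (auto simp: meas)
    then show ?thesis using is_torus_ft_powi[of 1] by simp
  next
    case False
    then have c: "c > 0" by (simp add: c_def zero_less_measure_iff)
    define \<nu> where "\<nu> = density \<eta> (\<lambda>_. ennreal (1 / c))"
    have "emeasure \<nu> (space \<nu>) = 1"
      using c by (simp add: \<nu>_def emeasure_density emeasure_eq_measure c_def[symmetric] ennreal_mult[symmetric])
    then have "torus_prob \<nu>"
      by (simp add: torus_prob_def prob_space.intro prob_spaceI \<nu>_def sets)
    moreover have "torus_ft \<nu> l = (\<integral>y. y powi l \<partial>\<eta>) / of_real c" for l
      unfolding \<nu>_def torus_ft_def using c
      by (subst integral_density) (auto simp: meas scaleR_conv_of_real)
    ultimately have "is_torus_ft (\<lambda>l. (\<integral>y. y powi l \<partial>\<eta>) / of_real c)"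
      unfolding is_torus_ft_def by blast
    from is_torus_ft_exp[OF this less_imp_le[OF c]] show ?thesis
      using c by (simp add: eq right_diff_distrib)
  qed
qed

section \<open>Generalised Poisson laws\<close>

text \<open>\<open>trunc_h (torus_arg y)\<close> on the circle, in a form whose continuity is
  visible; see \<open>trunc_h_torus_arg\<close>.\<close>

definition torus_h :: "complex \<Rightarrow> real" where
  "torus_h y = arcsin (Im y)"

lemma Im_torus_bounds: "y \<in> torus \<Longrightarrow> - 1 \<le> Im y \<and> Im y \<le> 1"
  using abs_Im_le_cmod[of y] by auto

lemma Re_torus_bounds: "y \<in> torus \<Longrightarrow> - 1 \<le> Re y \<and> Re y \<le> 1"
  using abs_Re_le_cmod[of y] by auto

lemma continuous_on_torus_h: "continuous_on torus torus_h"
  unfolding torus_h_def[abs_def]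
  by (intro continuous_on_arcsin continuous_intros ballI Im_torus_bounds)

lemma torus_h_bounds: "y \<in> torus \<Longrightarrow> - (pi / 2) \<le> torus_h y \<and> torus_h y \<le> pi / 2"
  unfolding torus_h_def using arcsin_bounded[of "Im y"] Im_torus_bounds[of y] by auto

lemma abs_torus_h_le_2: "y \<in> torus \<Longrightarrow> \<bar>torus_h y\<bar> \<le> 2"
  using torus_h_bounds[of y] pi_less_4 by linarith

lemma sin_torus_h: "y \<in> torus \<Longrightarrow> sin (torus_h y) = Im y"
  unfolding torus_h_def using Im_torus_bounds[of y] by simp

lemma torus_Re_Im: "y \<in> torus \<Longrightarrow> (Re y)\<^sup>2 + (Im y)\<^sup>2 = 1"
  using cmod_power2[of y] by simp

text \<open>In the right half plane the angle lies in \<open>[-pi/2, pi/2]\<close>, where truncation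
  does not reflect it.\<close>

lemma cis_torus_h:
  assumes "y \<in> torus" "Re y \<ge> 0"
  shows "cis (torus_h y) = y"
proof -
  have "cos (torus_h y) = sqrt (1 - (Im y)\<^sup>2)"
    unfolding torus_h_def using Im_torus_bounds[OF assms(1)] by (intro cos_arcsin) auto
  also have "1 - (Im y)\<^sup>2 = (Re y)\<^sup>2" using torus_Re_Im[OF assms(1)] by simp
  finally have "cos (torus_h y) = Re y" using assms by simp
  then show ?thesis using sin_torus_h[OF assms(1)] by (simp add: complex_eq_iff)
qed

text \<open>For \<open>\<bar>x\<bar> \<le> 2\<close> the Taylor error
  \<open>\<bar>x\<bar> ^ 3 / 6\<close> is at most \<open>2 / 3 * \<bar>x\<bar>\<close>, which leaves
  a third of \<open>\<bar>x\<bar>\<close> for the sine. The range covers the values of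
  \<open>torus_h\<close>, bounded by \<open>pi / 2\<close>.\<close>

lemma abs_le_3_abs_sin:
  fixes x :: real
  assumes "\<bar>x\<bar> \<le> 2"
  shows "\<bar>x\<bar> \<le> 3 * \<bar>sin x\<bar>"
proof -
  have "\<bar>sin x - x\<bar> \<le> \<bar>x\<bar> ^ 3 / 6"
    using Maclaurin_sin_bound[of x 3] by (simp add: eval_nat_numeral sin_coeff_def)
  moreover have "\<bar>x\<bar> ^ 3 \<le> 4 * \<bar>x\<bar>"
  proof -
    have "\<bar>x\<bar> * \<bar>x\<bar> \<le> 2 * 2" using assms by (intro mult_mono) auto
    then have "(\<bar>x\<bar> * \<bar>x\<bar>) * \<bar>x\<bar> \<le> 4 * \<bar>x\<bar>" by (intro mult_right_mono) auto
    then show ?thesis by (simp add: power3_eq_cube)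
  qed
  ultimately show ?thesis by linarith
qed

lemma abs_torus_h_le_Im: "y \<in> torus \<Longrightarrow> \<bar>torus_h y\<bar> \<le> 3 * \<bar>Im y\<bar>"
  using abs_le_3_abs_sin[OF abs_torus_h_le_2] sin_torus_h by metis

lemma abs_torus_h_le: "y \<in> torus \<Longrightarrow> \<bar>torus_h y\<bar> \<le> 3 * norm (y - 1)"
  using abs_torus_h_le_Im[of y] abs_Im_le_cmod[of "y - 1"] by simp

text \<open>\<open>1 - Re y\<close> is the quantity that a Levy measure integrates. The
  \<open>18\<close> is \<open>3\<^sup>2\<close> from the bound by \<open>Im y\<close>, times
  \<open>2\<close> from \<open>(Im y)\<^sup>2 = (1 + Re y) * (1 - Re y)\<close>.\<close>

lemma torus_h_sq_le:
  assumes y: "y \<in> torus"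
  shows "(torus_h y)\<^sup>2 \<le> 18 * (1 - Re y)"
proof -
  have "(torus_h y)\<^sup>2 \<le> (3 * \<bar>Im y\<bar>)\<^sup>2"
    using power_mono[OF abs_torus_h_le_Im[OF y] abs_ge_zero, of 2] by simp
  also have "\<dots> = 9 * ((1 + Re y) * (1 - Re y))"
    using torus_Re_Im[OF y] by (simp add: power2_eq_square algebra_simps)
  also have "\<dots> \<le> 9 * (2 * (1 - Re y))"
    using Re_torus_bounds[OF y] by (intro mult_left_mono mult_right_mono) auto
  finally show ?thesis by simp
qed

text \<open>For \<open>y\<close> in the right half plane \<open>y = cis (torus_h y)\<close>, and this is the remainder of the
  second-order Taylor expansion of \<open>exp (\<i> l (torus_h y - m))\<close>. Subtracting the mean \<open>m\<close> inside the
  exponential is essential: the row sums of squared means need not stay bounded.\<close>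

definition centred_remainder :: "int \<Rightarrow> real \<Rightarrow> complex \<Rightarrow> complex" where
  "centred_remainder l m y = y powi l * cis (- (l * m)) - 1 - \<i> * of_real (l * (torus_h y - m))
     + of_real ((l * (torus_h y - m))\<^sup>2 / 2)"

lemma continuous_on_centred_remainder: "continuous_on torus (centred_remainder l m)"
  unfolding centred_remainder_def[abs_def]
  by (intro continuous_intros continuous_on_torus_h) auto

lemma norm_cis_Taylor2:
  "norm (cis x - 1 - \<i> * of_real x + of_real (x\<^sup>2 / 2)) \<le> \<bar>x\<bar> ^ 3"
proof -
  have "(\<Sum>k\<le>2. (\<i> * x) ^ k / fact k) = 1 + \<i> * of_real x - of_real (x\<^sup>2 / 2)"
  proof -
    have "{..2::nat} = {0, 1, 2}" by auto
    then show ?thesis by (simp add: power_mult_distrib)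
  qed
  then have "cis x - 1 - \<i> * of_real x + of_real (x\<^sup>2 / 2) = iexp x - (\<Sum>k\<le>2. (\<i> * x) ^ k / fact k)"
    unfolding cis_conv_exp by (simp only: diff_diff_eq2 diff_diff_eq add.assoc) simp
  then have "norm (cis x - 1 - \<i> * of_real x + of_real (x\<^sup>2 / 2)) \<le> \<bar>x\<bar> ^ Suc 2 / fact (Suc 2)"
    using iexp_approx1[of x 2] by (simp only:)
  also have "\<dots> = \<bar>x\<bar> ^ 3 / 6" by (simp add: fact_numeral numeral_3_eq_3[symmetric] del: power_Suc)
  also have "\<dots> \<le> \<bar>x\<bar> ^ 3" using zero_le_power[OF abs_ge_zero, of x 3] by linarith
  finally show ?thesis .
qed

lemma norm_cis_minus_1_le: "norm (cis x - 1) \<le> \<bar>x\<bar>"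
  using iexp_approx1[of x 0] by (simp add: cis_conv_exp)

lemma norm_centred_remainder_le:
  assumes "y \<in> torus" "Re y \<ge> 0"
  shows "norm (centred_remainder l m y) \<le> (\<bar>real_of_int l\<bar> * \<bar>torus_h y - m\<bar>) ^ 3"
proof -
  have "y powi l = cis (l * torus_h y)"
    using cis_power_int[of "torus_h y" l] cis_torus_h[OF assms] by simp
  then have "y powi l * cis (- (l * m)) = cis (l * (torus_h y - m))"
    by (simp add: cis_mult algebra_simps)
  then show ?thesis
    using norm_cis_Taylor2[of "l * (torus_h y - m)"] by (simp add: centred_remainder_def abs_mult)
qed

text \<open>The price of dropping the centring, which must go because the test functions in (iv) may
  not vary with the entry. The rotation and the linear term cost \<open>\<bar>l * m\<bar>\<close>
  each; the quadratic term costs \<open>l\<^sup>2 / 2 * \<bar>m\<bar> * \<bar>m - 2 * torus_h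
  y\<bar>\<close>, whose last factor is at most \<open>6\<close>.\<close>

lemma centred_remainder_shift_le:
  assumes y: "y \<in> torus" and m: "\<bar>m\<bar> \<le> 2"
  shows "norm (centred_remainder l m y - centred_remainder l 0 y) \<le> (2 * \<bar>real_of_int l\<bar> + 3 * (real_of_int l)\<^sup>2) * \<bar>m\<bar>"
proof -
  let ?h = "torus_h y"
  have "centred_remainder l m y - centred_remainder l 0 y
      = y powi l * (cis (- (l * m)) - 1) + \<i> * of_real (l * m) + of_real ((real_of_int l)\<^sup>2 * (m * (m - 2 * ?h)) / 2)"
    by (simp add: centred_remainder_def power2_eq_square algebra_simps divide_simps)
  also have "norm \<dots> \<le> \<bar>real_of_int l\<bar> * \<bar>m\<bar> + \<bar>real_of_int l\<bar> * \<bar>m\<bar> + (real_of_int l)\<^sup>2 * (\<bar>m\<bar> * 6) / 2"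
  proof (intro norm_triangle_mono)
    show "norm (y powi l * (cis (- (l * m)) - 1)) \<le> \<bar>real_of_int l\<bar> * \<bar>m\<bar>"
      using norm_cis_minus_1_le[of "- (l * m)"] by (simp add: norm_mult norm_torus_powi[OF y] abs_mult)
    show "norm (\<i> * of_real (l * m)) \<le> \<bar>real_of_int l\<bar> * \<bar>m\<bar>"
      by (simp add: norm_mult)
    have "\<bar>m - 2 * ?h\<bar> \<le> 6" using abs_torus_h_le_2[OF y] m by linarith
    then have "(real_of_int l)\<^sup>2 * (\<bar>m\<bar> * \<bar>m - 2 * ?h\<bar>) / 2 \<le> (real_of_int l)\<^sup>2 * (\<bar>m\<bar> * 6) / 2"
      by (intro divide_right_mono mult_left_mono) auto
    then show "norm (complex_of_real ((real_of_int l)\<^sup>2 * (m * (m - 2 * ?h)) / 2)) \<le> (real_of_int l)\<^sup>2 * (\<bar>m\<bar> * 6) / 2"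
      unfolding norm_of_real by (simp add: abs_mult)
  qed
  finally show ?thesis by (simp add: algebra_simps)
qed

text \<open>In the right half plane the cubic bound applies, with
  \<open>\<bar>torus_h y\<bar> ^ 3 \<le> 2 * (18 * (1 - Re y))\<close>. In the left half plane
  \<open>1 - Re y > 1\<close>, so bounding the four terms by constants suffices. The factor adds up
  both cases.\<close>

lemma norm_centred_remainder_0_le:
  assumes y: "y \<in> torus"
  shows "norm (centred_remainder l 0 y) \<le> (36 * \<bar>real_of_int l\<bar> ^ 3 + 2 + 2 * \<bar>real_of_int l\<bar> + 2 * (real_of_int l)\<^sup>2) * (1 - Re y)"
    (is "_ \<le> ?C * _")
proof (cases "Re y \<ge> 0")
  case True
  have "norm (centred_remainder l 0 y) \<le> (\<bar>real_of_int l\<bar> * \<bar>torus_h y\<bar>) ^ 3"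
    using norm_centred_remainder_le[OF y True, of l 0] by simp
  also have "\<dots> = \<bar>real_of_int l\<bar> ^ 3 * (\<bar>torus_h y\<bar> * (torus_h y)\<^sup>2)"
  proof -
    have "\<bar>torus_h y\<bar> ^ 3 = \<bar>torus_h y\<bar> * (torus_h y)\<^sup>2"
      by (simp add: power3_eq_cube power2_eq_square mult.assoc)
    then show ?thesis by (simp add: power_mult_distrib)
  qed
  also have "\<dots> \<le> \<bar>real_of_int l\<bar> ^ 3 * (2 * (18 * (1 - Re y)))"
    using torus_h_sq_le[OF y] abs_torus_h_le_2[OF y] by (intro mult_left_mono mult_mono) auto
  also have "\<dots> = (36 * \<bar>real_of_int l\<bar> ^ 3) * (1 - Re y)" by simp
  also have "\<dots> \<le> ?C * (1 - Re y)"
    using Re_torus_bounds[OF y] by (intro mult_right_mono) auto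
  finally show ?thesis .
next
  case False
  let ?h = "torus_h y"
  have "norm (centred_remainder l 0 y) \<le> 1 + 1 + \<bar>real_of_int l\<bar> * 2 + (real_of_int l)\<^sup>2 * 2\<^sup>2 / 2"
    unfolding centred_remainder_def
  proof (intro norm_triangle_mono norm_triangle_le_diff add_mono)
    show "norm (y powi l * cis (- (real_of_int l * 0))) \<le> 1" by (simp add: norm_torus_powi[OF y])
    show "norm (\<i> * of_real (l * (?h - 0))) \<le> \<bar>real_of_int l\<bar> * 2"
      using abs_torus_h_le_2[OF y] by (auto simp: norm_mult intro!: mult_left_mono)
    have "?h\<^sup>2 \<le> 2\<^sup>2" using abs_torus_h_le_2[OF y] by (metis abs_le_square_iff abs_numeral)
    then have "(real_of_int l)\<^sup>2 * ?h\<^sup>2 \<le> (real_of_int l)\<^sup>2 * 2\<^sup>2"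
      by (intro mult_left_mono) auto
    then show "norm (complex_of_real ((l * (?h - 0))\<^sup>2 / 2)) \<le> (real_of_int l)\<^sup>2 * 2\<^sup>2 / 2"
      unfolding norm_of_real by (simp add: power_mult_distrib)
  qed simp
  also have "\<dots> \<le> ?C * 1" by simp
  also have "\<dots> \<le> ?C * (1 - Re y)" using False by (intro mult_left_mono) auto
  finally show ?thesis .
qed

section \<open>Integration against Levy measures\<close>

lemma levy_measure_sets: "levy_measure \<eta> \<Longrightarrow> sets \<eta> = sets torus_borel"
  by (simp add: levy_measure_def)

text \<open>The character of index \<open>1\<close> in the definition makes \<open>1 - Re y\<close>
  integrable, and this function dominates.\<close>

lemma levy_measure_integrable:
  fixes f :: "complex \<Rightarrow> 'b::{banach, second_countable_topology}"
  assumes \<eta>: "levy_measure \<eta>" and f: "continuous_on torus f"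
    and le: "\<And>y. y \<in> torus \<Longrightarrow> norm (f y) \<le> C * (1 - Re y)"
  shows "integrable \<eta> f"
proof -
  note sets = levy_measure_sets[OF \<eta>]
  have "(\<integral>\<^sup>+ y. ennreal (1 - Re (y powi 1)) \<partial>\<eta>) < \<infinity>"
    using \<eta> unfolding levy_measure_def by blast
  then have "integrable \<eta> (\<lambda>y. 1 - Re y)"
    using Re_torus_bounds
    by (intro integrableI_nonneg measurable_torus_continuous[OF sets] AE_I2)
       (auto simp: space_eq_torus[OF sets] intro!: continuous_intros)
  then have "integrable \<eta> (\<lambda>y. C * (1 - Re y))" by simp
  then show ?thesis
    by (rule Bochner_Integration.integrable_bound)
       (use le measurable_torus_continuous[OF sets f] in
         \<open>auto simp: space_eq_torus[OF sets] intro!: AE_I2 order_trans[OF _ abs_ge_self]\<close>)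
qed

lemma borel_nhd_one_cball: "r > 0 \<Longrightarrow> borel_nhd_one (torus \<inter> cball 1 r)"
  unfolding borel_nhd_one_def
proof (intro conjI exI)
  assume r: "r > 0"
  show "torus \<inter> cball 1 r \<in> sets torus_borel"
    unfolding torus_borel_def sets_restrict_space by auto
  show "openin (top_of_set torus) (torus \<inter> ball 1 r)" by (simp add: openin_open_Int)
  show "1 \<in> torus \<inter> ball 1 r" using r by simp
qed auto

text \<open>Both summands are dominated by multiples of \<open>1 - Re y\<close>, so they can be
  integrated separately; the quadratic one is later matched with the \<eta>-part of the variance
  limit.\<close>

lemma gen_poisson_integrand:
  assumes "y \<in> torus"
  shows "y powi l - 1 - \<i> * of_real (torus_g y l)
    = centred_remainder l 0 y - of_real ((real_of_int l)\<^sup>2 / 2) * of_real ((torus_h y)\<^sup>2)"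
  by (simp add: torus_g_def trunc_h_torus_arg[OF assms] torus_h_def[symmetric]
      centred_remainder_def power_mult_distrib)

lemma levy_measure_integrable_h_sq:
  assumes "levy_measure \<eta>"
  shows "integrable \<eta> (\<lambda>y. (torus_h y)\<^sup>2)"
proof (rule levy_measure_integrable[OF assms])
  show "norm ((torus_h y)\<^sup>2) \<le> 18 * (1 - Re y)" if "y \<in> torus" for y
    using torus_h_sq_le[OF that] by simp
qed (intro continuous_intros continuous_on_torus_h)

lemma levy_measure_integrable_remainder:
  "levy_measure \<eta> \<Longrightarrow> integrable \<eta> (centred_remainder l 0)"
  by (rule levy_measure_integrable[OF _ continuous_on_centred_remainder norm_centred_remainder_0_le])

lemma levy_measure_integral_gen_poisson:
  assumes \<eta>: "levy_measure \<eta>"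
  shows "integrable \<eta> (\<lambda>y. y powi l - 1 - \<i> * of_real (torus_g y l))"
    and "(\<integral>y. (y powi l - 1 - \<i> * of_real (torus_g y l)) \<partial>\<eta>)
      = (\<integral>y. centred_remainder l 0 y \<partial>\<eta>) - of_real ((real_of_int l)\<^sup>2 / 2 * (\<integral>y. (torus_h y)\<^sup>2 \<partial>\<eta>))"
proof -
  note sets = levy_measure_sets[OF \<eta>]
  have int': "integrable \<eta> (\<lambda>y. of_real ((real_of_int l)\<^sup>2 / 2) * complex_of_real ((torus_h y)\<^sup>2))"
    by (intro integrable_mult_right integrable_of_real levy_measure_integrable_h_sq[OF \<eta>])
  have int: "integrable \<eta> (\<lambda>y. centred_remainder l 0 y - of_real ((real_of_int l)\<^sup>2 / 2) * of_real ((torus_h y)\<^sup>2))"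
    by (intro Bochner_Integration.integrable_diff levy_measure_integrable_remainder[OF \<eta>] int')
  show "integrable \<eta> (\<lambda>y. y powi l - 1 - \<i> * of_real (torus_g y l))"
    by (subst Bochner_Integration.integrable_cong[OF refl gen_poisson_integrand])
       (use int in \<open>auto simp: space_eq_torus[OF sets]\<close>)
  have "(\<integral>y. (y powi l - 1 - \<i> * of_real (torus_g y l)) \<partial>\<eta>)
    = (\<integral>y. (centred_remainder l 0 y - of_real ((real_of_int l)\<^sup>2 / 2) * of_real ((torus_h y)\<^sup>2)) \<partial>\<eta>)"
    by (rule torus_integral_cong[OF sets]) (simp add: gen_poisson_integrand)
  also have "\<dots> = (\<integral>y. centred_remainder l 0 y \<partial>\<eta>) - of_real ((real_of_int l)\<^sup>2 / 2 * (\<integral>y. (torus_h y)\<^sup>2 \<partial>\<eta>))"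
    unfolding Bochner_Integration.integral_diff[OF levy_measure_integrable_remainder[OF \<eta>] int']
      integral_mult_right_zero integral_complex_of_real
    by simp
  finally show "(\<integral>y. (y powi l - 1 - \<i> * of_real (torus_g y l)) \<partial>\<eta>)
      = (\<integral>y. centred_remainder l 0 y \<partial>\<eta>) - of_real ((real_of_int l)\<^sup>2 / 2 * (\<integral>y. (torus_h y)\<^sup>2 \<partial>\<eta>))"
    by simp
qed

text \<open>For finite mass the compensator can be integrated on its own, and it merely rotates a
  compound Poisson law by \<open>cis (- t)\<close>.\<close>

lemma is_torus_ft_gen_poisson_finite:
  assumes sets: "sets \<eta> = sets torus_borel" and "finite_measure \<eta>"
  shows "is_torus_ft (\<lambda>l. exp (\<integral>y. (y powi l - 1 - \<i> * of_real (torus_g y l)) \<partial>\<eta>))"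
proof -
  interpret finite_measure \<eta> by fact
  define t where "t = (\<integral>y. torus_h y \<partial>\<eta>)"
  have "integrable \<eta> torus_h"
    by (rule integrable_const_bound[where B = 2])
       (use abs_torus_h_le_2 measurable_torus_continuous[OF sets continuous_on_torus_h] in
         \<open>auto simp: space_eq_torus[OF sets]\<close>)
  moreover have "integrable \<eta> (\<lambda>y. y powi l - 1)" for l
    by (intro Bochner_Integration.integrable_diff integrable_const_bound[where B = 1])
       (use measurable_torus_continuous[OF sets continuous_on_torus_powi] in
         \<open>auto simp: space_eq_torus[OF sets] norm_power_int\<close>)
  ultimately have *: "(\<integral>y. (y powi l - 1 - \<i> * of_real (l * torus_h y)) \<partial>\<eta>)
      = (\<integral>y. (y powi l - 1) \<partial>\<eta>) - \<i> * of_real (l * t)" for l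
    by (simp add: t_def)
  have "(\<integral>y. (y powi l - 1 - \<i> * of_real (torus_g y l)) \<partial>\<eta>)
      = (\<integral>y. (y powi l - 1) \<partial>\<eta>) - \<i> * of_real (l * t)" for l
    unfolding *[symmetric]
    by (rule torus_integral_cong[OF sets]) (simp add: torus_g_def trunc_h_torus_arg torus_h_def)
  moreover have "exp (a - \<i> * of_real (l * t)) = exp a * cis (- t) powi l" for a l
    unfolding cis_power_int by (simp add: cis_conv_exp exp_add[symmetric])
  ultimately have "exp (\<integral>y. (y powi l - 1 - \<i> * of_real (torus_g y l)) \<partial>\<eta>)
      = exp (\<integral>y. (y powi l - 1) \<partial>\<eta>) * cis (- t) powi l" for l
    by (simp only:)
  then show ?thesis
    using is_torus_ft_mult[OF is_torus_ft_compound_poisson[OF assms] is_torus_ft_powi[of "cis (- t)"]]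
    by simp
qed

text \<open>Removing small balls about \<open>1\<close> leaves finite measures. Their exponents
  converge by dominated convergence, with the norm of the full integrand as majorant, and
  \<open>is_torus_ft_limit\<close> supplies the law.\<close>

lemma is_torus_ft_gen_poisson:
  assumes \<eta>: "levy_measure \<eta>"
  shows "is_torus_ft (\<lambda>l. exp (\<integral>y. (y powi l - 1 - \<i> * of_real (torus_g y l)) \<partial>\<eta>))"
proof -
  note sets = levy_measure_sets[OF \<eta>]
  define A where "A n = torus - (torus \<inter> cball 1 (1 / real (Suc n)))" for n
  have nhd: "borel_nhd_one (torus \<inter> cball 1 (1 / real (Suc n)))" for n
    by (rule borel_nhd_one_cball) simp
  have A: "A n \<in> sets \<eta>" for n
    using nhd[of n] sets.compl_sets[of _ torus_borel] unfolding A_def sets borel_nhd_one_def by simp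
  define \<eta>' where "\<eta>' n = density \<eta> (indicator (A n))" for n
  let ?f = "\<lambda>l y. y powi l - 1 - \<i> * of_real (torus_g y l)"
  have fin: "finite_measure (\<eta>' n)" for n
  proof (rule finite_measureI)
    have "emeasure (\<eta>' n) (space (\<eta>' n)) = emeasure \<eta> (A n)"
      using A[of n] by (simp add: \<eta>'_def emeasure_density nn_integral_indicator)
    also have "\<dots> < \<infinity>" using \<eta> nhd[of n] unfolding A_def levy_measure_def by blast
    finally show "emeasure (\<eta>' n) (space (\<eta>' n)) \<noteq> \<infinity>" by simp
  qed
  have meas: "?f l \<in> borel_measurable \<eta>" for l
    using levy_measure_integral_gen_poisson(1)[OF \<eta>] by (rule borel_measurable_integrable)
  have eq: "(\<integral>y. ?f l y \<partial>\<eta>' n) = (\<integral>y. indicator (A n) y *\<^sub>R ?f l y \<partial>\<eta>)" for l n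
    unfolding \<eta>'_def ennreal_indicator[symmetric]
    using A[of n] meas[of l] by (intro integral_density) (auto intro!: borel_measurable_indicator)
  have "(\<lambda>n. \<integral>y. ?f l y \<partial>\<eta>' n) \<longlonglongrightarrow> (\<integral>y. ?f l y \<partial>\<eta>)" for l
    unfolding eq
  proof (rule integral_dominated_convergence[where w = "\<lambda>y. norm (?f l y)"])
    show "AE y in \<eta>. (\<lambda>n. indicator (A n) y *\<^sub>R ?f l y) \<longlonglongrightarrow> ?f l y"
    proof (rule AE_I2)
      fix y assume "y \<in> space \<eta>"
      then have y: "y \<in> torus" by (simp add: space_eq_torus[OF sets])
      show "(\<lambda>n. indicator (A n) y *\<^sub>R ?f l y) \<longlonglongrightarrow> ?f l y"
      proof (cases "y = 1")
        case True
        \<comment> \<open>The point \<open>1\<close> lies in no \<open>A n\<close>, but the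
          integrand vanishes there.\<close>
        have "?f l y = 0" using True by (simp add: torus_g_def trunc_h_torus_arg)
        then show ?thesis by simp
      next
        case False
        then have d: "dist 1 y > 0" by simp
        obtain N where N: "inverse (real (Suc N)) < dist 1 y" using reals_Archimedean[OF d] by blast
        have "y \<in> A n" if "n \<ge> N" for n
        proof -
          have "1 / real (Suc n) \<le> inverse (real (Suc N))" using that by (simp add: divide_simps)
          then show ?thesis using N y unfolding A_def by auto
        qed
        then show ?thesis
          by (intro tendsto_eventually eventually_sequentiallyI[of N]) simp
      qed
    qed
    show "(\<lambda>y. indicator (A n) y *\<^sub>R ?f l y) \<in> borel_measurable \<eta>" for n
      using meas[of l] A[of n] by (intro borel_measurable_scaleR borel_measurable_indicator)
    show "AE y in \<eta>. norm (indicator (A n) y *\<^sub>R ?f l y) \<le> norm (?f l y)" for n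
      by (intro AE_I2) (auto simp: indicator_def)
  qed (use meas levy_measure_integral_gen_poisson(1)[OF \<eta>] in \<open>auto intro: integrable_norm\<close>)
  then have lim: "(\<lambda>n. exp (\<integral>y. ?f l y \<partial>\<eta>' n)) \<longlonglongrightarrow> exp (\<integral>y. ?f l y \<partial>\<eta>)" for l
    by (rule tendsto_exp)
  have "is_torus_ft (\<lambda>l. exp (\<integral>y. ?f l y \<partial>\<eta>' n))" for n
    by (rule is_torus_ft_gen_poisson_finite[OF _ fin]) (simp add: \<eta>'_def sets)
  then show ?thesis using lim by (rule is_torus_ft_limit)
qed

lemma gen_poisson_measure_ft:
  assumes "levy_measure \<eta>"
  shows "torus_prob (gen_poisson_measure \<eta>)"
    and "torus_ft (gen_poisson_measure \<eta>) l = exp (\<integral>y. (y powi l - 1 - \<i> * of_real (torus_g y l)) \<partial>\<eta>)"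
  using is_torus_ft_The[OF is_torus_ft_gen_poisson[OF assms]]
  unfolding gen_poisson_measure_def by auto

section \<open>Estimates for a single entry\<close>

lemma norm_torus_powi_diff_le:
  assumes y: "y \<in> torus"
  shows "norm (y powi l - 1) \<le> \<bar>real_of_int l\<bar> * norm (y - 1)"
proof -
  have n: "norm y = 1" using y by simp
  have pow: "norm (y ^ n - 1) \<le> real n * norm (y - 1)" for n
    using norm_power_diff[of y 1 n] n by simp
  show ?thesis
  proof (cases l)
    case (nonneg n)
    then show ?thesis using pow[of n] by simp
  next
    case (neg n)
    have "y powi l - 1 = (1 - y ^ Suc n) / y ^ Suc n"
      unfolding neg power_int_minus power_int_of_nat using torus_nonzero[OF y]
      by (simp add: diff_divide_distrib inverse_eq_divide)
    then have "norm (y powi l - 1) = norm (y ^ Suc n - 1)"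
      using n by (simp add: norm_divide norm_mult norm_power norm_minus_commute)
    then show ?thesis using pow[of "Suc n"] neg by (simp add: add.commute)
  qed
qed

text \<open>A continuous substitute for the indicator of the complement of a ball about
  \<open>1\<close>, rising between distances \<open>d\<close> and \<open>2 * d\<close>: the test
  functions in (iv) are continuous and vanish near \<open>1\<close>.\<close>

definition torus_cutoff :: "real \<Rightarrow> complex \<Rightarrow> real" where
  "torus_cutoff d y = max 0 (min 1 (norm (y - 1) / d - 1))"

lemma torus_cutoff_bounds: "0 \<le> torus_cutoff d y" "torus_cutoff d y \<le> 1"
  by (auto simp: torus_cutoff_def)

lemma continuous_on_torus_cutoff: "continuous_on S (torus_cutoff d)"
  unfolding torus_cutoff_def[abs_def] divide_inverse by (intro continuous_intros)

lemma torus_cutoff_eq_0: "d > 0 \<Longrightarrow> norm (y - 1) \<le> d \<Longrightarrow> torus_cutoff d y = 0"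
  by (auto simp: torus_cutoff_def field_simps)

lemma torus_cutoff_eq_1: "d > 0 \<Longrightarrow> norm (y - 1) \<ge> 2 * d \<Longrightarrow> torus_cutoff d y = 1"
  by (auto simp: torus_cutoff_def field_simps)

lemma torus_cutoff_mult_C0:
  assumes d: "d > 0" and f: "continuous_on torus f"
  shows "(\<lambda>y. torus_cutoff d y * f y) \<in> torus_C0"
proof -
  have c: "continuous_on torus (\<lambda>y. torus_cutoff d y * f y)"
    by (intro continuous_intros continuous_on_torus_cutoff f)
  then have "bounded ((\<lambda>y. torus_cutoff d y * f y) ` torus)"
    using compact_continuous_image compact_sphere compact_imp_bounded by blast
  moreover have "borel_nhd_one (torus \<inter> cball 1 d)" using d by (rule borel_nhd_one_cball)
  moreover have "\<forall>y\<in>torus \<inter> cball 1 d. torus_cutoff d y * f y = 0"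
    using d torus_cutoff_eq_0 by (auto simp: dist_norm norm_minus_commute)
  ultimately show ?thesis unfolding torus_C0_def using c by blast
qed

text \<open>With cutoff \<phi> and remainder \<open>S m\<close>, the difference is
  \<open>(1 - \<phi>) * S m + \<phi> * (S m - S 0)\<close>. The first part lives within distance
  \<open>2 * d\<close> of \<open>1\<close>; there one factor of the cubic bound is at most
  \<open>6 * d + \<bar>m\<bar>\<close>, and the remaining square integrates to the variance. The
  second part is the shift estimate.\<close>

lemma centred_remainder_cutoff_le:
  assumes y: "y \<in> torus" and m: "\<bar>m\<bar> \<le> 2" and d: "0 < d" "d \<le> 1 / 2"
  shows "norm (centred_remainder l m y - torus_cutoff d y * centred_remainder l 0 y)
    \<le> \<bar>real_of_int l\<bar> ^ 3 * (6 * d + \<bar>m\<bar>) * (torus_h y - m)\<^sup>2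
      + (2 * \<bar>real_of_int l\<bar> + 3 * (real_of_int l)\<^sup>2) * \<bar>m\<bar> * torus_cutoff d y"
    (is "_ \<le> ?A + ?C * \<bar>m\<bar> * ?\<phi>")
proof -
  let ?S = "\<lambda>m. centred_remainder l m y"
  have phi: "0 \<le> ?\<phi>" "?\<phi> \<le> 1" by (rule torus_cutoff_bounds)+
  have "?S m - ?\<phi> * ?S 0 = of_real (1 - ?\<phi>) * ?S m + of_real ?\<phi> * (?S m - ?S 0)"
    by (simp add: algebra_simps)
  then have "norm (?S m - ?\<phi> * ?S 0) \<le> norm (of_real (1 - ?\<phi>) * ?S m) + norm (of_real ?\<phi> * (?S m - ?S 0))"
    by (simp only: norm_triangle_ineq)
  also have "\<dots> = (1 - ?\<phi>) * norm (?S m) + ?\<phi> * norm (?S m - ?S 0)"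
    unfolding norm_mult norm_of_real using phi by simp
  also have "\<dots> \<le> ?A + ?\<phi> * (?C * \<bar>m\<bar>)"
  proof (intro add_mono mult_left_mono centred_remainder_shift_le y m phi)
    show "(1 - ?\<phi>) * norm (?S m) \<le> ?A"
    proof (cases "norm (y - 1) \<ge> 2 * d")
      case True
      then show ?thesis using d by (simp add: torus_cutoff_eq_1)
    next
      case False
      \<comment> \<open>Here \<open>2 * d \<le> 1\<close> keeps \<open>y\<close> in the right half
        plane.\<close>
      have "Re y \<ge> 0" using abs_Re_le_cmod[of "y - 1"] False d by simp
      then have "norm (?S m) \<le> (\<bar>real_of_int l\<bar> * \<bar>torus_h y - m\<bar>) ^ 3"
        by (rule norm_centred_remainder_le[OF y])
      also have "\<dots> = \<bar>real_of_int l\<bar> ^ 3 * \<bar>torus_h y - m\<bar> * (torus_h y - m)\<^sup>2"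
      proof -
        have "\<bar>torus_h y - m\<bar> ^ 3 = \<bar>torus_h y - m\<bar> * (torus_h y - m)\<^sup>2"
          by (simp add: power3_eq_cube power2_eq_square mult.assoc)
        then show ?thesis by (simp add: power_mult_distrib)
      qed
      also have "\<dots> \<le> ?A"
      proof (intro mult_right_mono mult_left_mono)
        show "\<bar>torus_h y - m\<bar> \<le> 6 * d + \<bar>m\<bar>"
          using abs_torus_h_le[OF y] False by linarith
      qed auto
      finally have "norm (?S m) \<le> ?A" .
      moreover have "(1 - ?\<phi>) * norm (?S m) \<le> 1 * norm (?S m)"
        using phi by (intro mult_right_mono) auto
      ultimately show ?thesis by linarith
    qed
  qed
  finally show ?thesis by (simp add: mult_ac)
qed

section \<open>Mean, variance and centred transform of a single law\<close>

lemma torus_prob_mono_integral: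
  fixes f :: "complex \<Rightarrow> 'b::{banach, second_countable_topology}"
  assumes \<mu>: "torus_prob \<mu>" and f: "continuous_on torus f" and g: "continuous_on torus g"
    and le: "\<And>y. y \<in> torus \<Longrightarrow> norm (f y) \<le> g y"
  shows "norm (\<integral>y. f y \<partial>\<mu>) \<le> (\<integral>y. g y \<partial>\<mu>)"
proof -
  have "norm (\<integral>y. f y \<partial>\<mu>) \<le> (\<integral>y. norm (f y) \<partial>\<mu>)" by (rule integral_norm_bound)
  also have "\<dots> \<le> (\<integral>y. g y \<partial>\<mu>)"
    using le by (intro integral_mono integrable_norm torus_prob_integrable[OF \<mu>] f g)
      (auto simp: torus_prob_in_space[OF \<mu>])
  finally show ?thesis .
qed

definition h_mean :: "complex measure \<Rightarrow> real" where
  "h_mean \<mu> = (\<integral>y. torus_h y \<partial>\<mu>)"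

definition h_var :: "complex measure \<Rightarrow> real" where
  "h_var \<mu> = (\<integral>y. (torus_h y - h_mean \<mu>)\<^sup>2 \<partial>\<mu>)"

lemma h_var_nonneg: "0 \<le> h_var \<mu>"
  unfolding h_var_def by simp

lemma abs_h_mean_le_2:
  assumes \<mu>: "torus_prob \<mu>"
  shows "\<bar>h_mean \<mu>\<bar> \<le> 2"
proof -
  interpret prob_space \<mu> using \<mu> by (rule torus_prob_space)
  show ?thesis
    using torus_prob_mono_integral[OF \<mu> continuous_on_torus_h, of "\<lambda>_. 2"] abs_torus_h_le_2
    by (simp add: h_mean_def prob_space)
qed

lemma abs_h_mean_le:
  assumes \<mu>: "torus_prob \<mu>"
  shows "\<bar>h_mean \<mu>\<bar> \<le> 3 * (\<integral>y. norm (y - 1) \<partial>\<mu>)"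
proof -
  have "continuous_on torus (\<lambda>y. 3 * norm (y - 1))" by (intro continuous_intros)
  from torus_prob_mono_integral[OF \<mu> continuous_on_torus_h this] abs_torus_h_le
  show ?thesis by (simp add: h_mean_def)
qed

text \<open>Centring makes the linear term integrate to \<open>0\<close>, and the quadratic term
  then gives the variance instead of the second moment.\<close>

lemma centred_ft_eq:
  assumes \<mu>: "torus_prob \<mu>"
  defines "m \<equiv> h_mean \<mu>"
  shows "torus_ft \<mu> l * cis (- (l * m)) - 1
    = (\<integral>y. centred_remainder l m y \<partial>\<mu>) - of_real ((real_of_int l)\<^sup>2 / 2 * h_var \<mu>)"
proof -
  interpret prob_space \<mu> using \<mu> by (rule torus_prob_space)
  note int = torus_prob_integrable[OF \<mu>]
  have 1: "integrable \<mu> (\<lambda>y. y powi l)" by (rule int[OF continuous_on_torus_powi])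
  have 2: "integrable \<mu> torus_h" by (rule int[OF continuous_on_torus_h])
  have 3: "integrable \<mu> (\<lambda>y. (torus_h y - m)\<^sup>2)"
    by (intro int continuous_intros continuous_on_torus_h)
  have eq: "centred_remainder l m y = y powi l * cis (- (l * m)) - 1 - \<i> * (l * of_real (torus_h y - m))
     + of_real ((real_of_int l)\<^sup>2 / 2) * of_real ((torus_h y - m)\<^sup>2)" for y
    by (simp add: centred_remainder_def power_mult_distrib)
  have 4: "integrable \<mu> (\<lambda>y. complex_of_real (torus_h y - m))"
    "integrable \<mu> (\<lambda>y. complex_of_real ((torus_h y - m)\<^sup>2))"
    using 2 3 by (intro integrable_of_real; simp)+
  have "(\<integral>y. complex_of_real (torus_h y - m) \<partial>\<mu>) = 0"
    unfolding integral_complex_of_real using 2 by (simp add: m_def h_mean_def prob_space)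
  moreover have "(\<integral>y. complex_of_real ((torus_h y - m)\<^sup>2) \<partial>\<mu>) = of_real (h_var \<mu>)"
    unfolding integral_complex_of_real by (simp add: m_def h_var_def)
  ultimately have "(\<integral>y. centred_remainder l m y \<partial>\<mu>) = torus_ft \<mu> l * cis (- (l * m)) - 1 - \<i> * (l * 0)
      + of_real ((real_of_int l)\<^sup>2 / 2) * of_real (h_var \<mu>)"
    unfolding eq torus_ft_def using 1 4
    by (simp add: prob_space del: of_real_diff of_real_power)
  then show ?thesis by simp
qed

text \<open>The uniform smallness of the centred factors. The \<open>4\<close> is \<open>1\<close>
  from the character plus \<open>3\<close> from the centring, by
  \<open>abs_h_mean_le\<close>.\<close>

lemma norm_centred_ft_le:
  assumes \<mu>: "torus_prob \<mu>"
  shows "norm (torus_ft \<mu> l * cis (- (l * h_mean \<mu>)) - 1)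
    \<le> 4 * \<bar>real_of_int l\<bar> * (\<integral>y. norm (y - 1) \<partial>\<mu>)"
proof -
  interpret prob_space \<mu> using \<mu> by (rule torus_prob_space)
  let ?m = "h_mean \<mu>"
  have int: "integrable \<mu> (\<lambda>y. y powi l)"
    by (rule torus_prob_integrable[OF \<mu> continuous_on_torus_powi])
  have int': "integrable \<mu> (\<lambda>y. norm (y - 1))"
    by (intro torus_prob_integrable[OF \<mu>] continuous_intros)
  have eq: "torus_ft \<mu> l * cis (- (l * ?m)) - 1 = (\<integral>y. y powi l * cis (- (l * ?m)) - 1 \<partial>\<mu>)"
    using int by (simp add: torus_ft_def prob_space)
  have "norm (torus_ft \<mu> l * cis (- (l * ?m)) - 1) \<le> (\<integral>y. \<bar>real_of_int l\<bar> * norm (y - 1) + \<bar>real_of_int l\<bar> * \<bar>?m\<bar> \<partial>\<mu>)"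
    unfolding eq
  proof (rule torus_prob_mono_integral[OF \<mu>])
    fix y :: complex assume y: "y \<in> torus"
    have "norm (y powi l * cis (- (l * ?m)) - 1) = norm ((y powi l - 1) * cis (- (l * ?m)) + (cis (- (l * ?m)) - 1))"
      by (simp add: algebra_simps)
    also have "\<dots> \<le> norm (y powi l - 1) + \<bar>real_of_int l\<bar> * \<bar>?m\<bar>"
      using norm_cis_minus_1_le[of "- (l * ?m)"]
      by (intro norm_triangle_mono) (simp_all add: norm_mult abs_mult)
    finally show "norm (y powi l * cis (- (l * ?m)) - 1) \<le> \<bar>real_of_int l\<bar> * norm (y - 1) + \<bar>real_of_int l\<bar> * \<bar>?m\<bar>"
      using norm_torus_powi_diff_le[OF y, of l] by linarith
  qed (intro continuous_on_diff continuous_on_add continuous_on_mult_right continuous_on_mult_left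
      continuous_on_norm continuous_on_torus_powi continuous_on_const continuous_on_id)+
  also have "\<dots> = \<bar>real_of_int l\<bar> * ((\<integral>y. norm (y - 1) \<partial>\<mu>) + \<bar>?m\<bar>)"
    using int' by (simp add: prob_space algebra_simps)
  also have "\<dots> \<le> \<bar>real_of_int l\<bar> * (4 * (\<integral>y. norm (y - 1) \<partial>\<mu>))"
    using abs_h_mean_le[OF \<mu>] by (intro mult_left_mono) auto
  finally show ?thesis by simp
qed

lemma integral_centred_remainder_cutoff_le:
  assumes \<mu>: "torus_prob \<mu>" and d: "0 < d" "d \<le> 1 / 2"
  defines "m \<equiv> h_mean \<mu>"
  shows "norm ((\<integral>y. centred_remainder l m y \<partial>\<mu>) - (\<integral>y. torus_cutoff d y * centred_remainder l 0 y \<partial>\<mu>))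
    \<le> \<bar>real_of_int l\<bar> ^ 3 * (6 * d + \<bar>m\<bar>) * h_var \<mu>
      + (2 * \<bar>real_of_int l\<bar> + 3 * (real_of_int l)\<^sup>2) * \<bar>m\<bar> * (\<integral>y. torus_cutoff d y \<partial>\<mu>)"
    (is "_ \<le> ?A * _ + ?C * _ * _")
proof -
  note int = torus_prob_integrable[OF \<mu>]
  have c1: "continuous_on torus (\<lambda>y. torus_cutoff d y * centred_remainder l 0 y)"
    by (intro continuous_intros continuous_on_torus_cutoff continuous_on_centred_remainder)
  have c2: "continuous_on torus (\<lambda>y. (torus_h y - m)\<^sup>2)"
    by (intro continuous_intros continuous_on_torus_h)
  have eq: "(\<integral>y. centred_remainder l m y \<partial>\<mu>) - (\<integral>y. torus_cutoff d y * centred_remainder l 0 y \<partial>\<mu>)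
      = (\<integral>y. centred_remainder l m y - torus_cutoff d y * centred_remainder l 0 y \<partial>\<mu>)"
    by (rule Bochner_Integration.integral_diff[symmetric])
       (rule int[OF continuous_on_centred_remainder] int[OF c1])+
  have "norm ((\<integral>y. centred_remainder l m y \<partial>\<mu>) - (\<integral>y. torus_cutoff d y * centred_remainder l 0 y \<partial>\<mu>))
      \<le> (\<integral>y. ?A * (torus_h y - m)\<^sup>2 + ?C * \<bar>m\<bar> * torus_cutoff d y \<partial>\<mu>)"
    unfolding eq using abs_h_mean_le_2[OF \<mu>] d unfolding m_def
    by (intro torus_prob_mono_integral[OF \<mu>] centred_remainder_cutoff_le)
       (auto intro!: continuous_intros continuous_on_torus_cutoff continuous_on_centred_remainder continuous_on_torus_h)
  also have "\<dots> = ?A * h_var \<mu> + ?C * \<bar>m\<bar> * (\<integral>y. torus_cutoff d y \<partial>\<mu>)"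
    using int[OF c2] int[OF continuous_on_torus_cutoff] by (simp add: h_var_def m_def)
  finally show ?thesis .
qed

section \<open>Triangular arrays of laws\<close>

text \<open>The limit problem in terms of laws alone. Condition (i) enters as a vanishing bound
  \<open>u\<close> on the mean distance to \<open>1\<close>; (ii) appears only in the last theorem
  of the locale, because it concerns the factors split off by the centring.\<close>

locale torus_triangular_array =
  fixes \<mu> :: "nat \<Rightarrow> nat \<Rightarrow> complex measure" and K :: "nat \<Rightarrow> nat"
    and b :: real and \<eta> :: "complex measure" and u :: "nat \<Rightarrow> real"
  assumes prob: "\<And>n k. k \<in> {1..K n} \<Longrightarrow> torus_prob (\<mu> n k)"
    and levy: "levy_measure \<eta>"
    and dist_le: "\<And>n k. k \<in> {1..K n} \<Longrightarrow> (\<integral>y. norm (y - 1) \<partial>\<mu> n k) \<le> u n"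
    and u_tendsto: "u \<longlonglongrightarrow> 0"
    and var_tendsto: "(\<lambda>n. \<Sum>k=1..K n. h_var (\<mu> n k)) \<longlonglongrightarrow> b + (\<integral>y. (torus_h y)\<^sup>2 \<partial>\<eta>)"
    and C0_tendsto: "\<And>f. f \<in> torus_C0 \<Longrightarrow>
      (\<lambda>n. \<Sum>k=1..K n. (\<integral>y. f y \<partial>\<mu> n k)) \<longlonglongrightarrow> (\<integral>y. f y \<partial>\<eta>)"
begin

lemma abs_h_mean_le_u: "k \<in> {1..K n} \<Longrightarrow> \<bar>h_mean (\<mu> n k)\<bar> \<le> 3 * u n"
  using abs_h_mean_le[OF prob, of k n] dist_le[of k n] by linarith

text \<open>\<open>torus_C0\<close> consists of real functions, so (iv) is applied to real and
  imaginary parts separately.\<close>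

lemma cutoff_remainder_tendsto:
  assumes d: "d > 0"
  shows "(\<lambda>n. \<Sum>k=1..K n. (\<integral>y. torus_cutoff d y * centred_remainder l 0 y \<partial>\<mu> n k))
    \<longlonglongrightarrow> (\<integral>y. torus_cutoff d y * centred_remainder l 0 y \<partial>\<eta>)"
proof -
  let ?f = "\<lambda>y. torus_cutoff d y * centred_remainder l 0 y"
  have c: "continuous_on torus ?f"
    by (intro continuous_intros continuous_on_torus_cutoff continuous_on_centred_remainder)
  have int_\<mu>: "integrable (\<mu> n k) ?f" if "k \<in> {1..K n}" for n k
    by (rule torus_prob_integrable[OF prob[OF that] c])
  have int_\<eta>: "integrable \<eta> ?f"
  proof (rule levy_measure_integrable[OF levy c])
    fix y :: complex assume y: "y \<in> torus"
    have "norm (?f y) \<le> norm (centred_remainder l 0 y)"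
      unfolding norm_mult norm_of_real using torus_cutoff_bounds[of d y]
      by (intro mult_left_le_one_le) auto
    with norm_centred_remainder_0_le[OF y, of l]
    show "norm (?f y) \<le> (36 * \<bar>real_of_int l\<bar> ^ 3 + 2 + 2 * \<bar>real_of_int l\<bar> + 2 * (real_of_int l)\<^sup>2) * (1 - Re y)"
      by linarith
  qed
  have C0: "(\<lambda>y. torus_cutoff d y * Re (centred_remainder l 0 y)) \<in> torus_C0"
    "(\<lambda>y. torus_cutoff d y * Im (centred_remainder l 0 y)) \<in> torus_C0"
    by (intro torus_cutoff_mult_C0 d continuous_intros continuous_on_centred_remainder)+
  have Re_eq: "Re (\<integral>y. ?f y \<partial>\<rho>) = (\<integral>y. torus_cutoff d y * Re (centred_remainder l 0 y) \<partial>\<rho>)"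
    and Im_eq: "Im (\<integral>y. ?f y \<partial>\<rho>) = (\<integral>y. torus_cutoff d y * Im (centred_remainder l 0 y) \<partial>\<rho>)"
    if "integrable \<rho> ?f" for \<rho>
    using integral_Re[OF that] integral_Im[OF that] by simp_all
  have "(\<Sum>k=1..K n. Re (\<integral>y. ?f y \<partial>\<mu> n k))
      = (\<Sum>k=1..K n. (\<integral>y. torus_cutoff d y * Re (centred_remainder l 0 y) \<partial>\<mu> n k))" for n
    by (rule sum.cong[OF refl]) (rule Re_eq[OF int_\<mu>])
  then have Re: "(\<lambda>n. \<Sum>k=1..K n. Re (\<integral>y. ?f y \<partial>\<mu> n k)) \<longlonglongrightarrow> Re (\<integral>y. ?f y \<partial>\<eta>)"
    using C0_tendsto[OF C0(1)] by (simp only: Re_eq[OF int_\<eta>])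
  have "(\<Sum>k=1..K n. Im (\<integral>y. ?f y \<partial>\<mu> n k))
      = (\<Sum>k=1..K n. (\<integral>y. torus_cutoff d y * Im (centred_remainder l 0 y) \<partial>\<mu> n k))" for n
    by (rule sum.cong[OF refl]) (rule Im_eq[OF int_\<mu>])
  then have Im: "(\<lambda>n. \<Sum>k=1..K n. Im (\<integral>y. ?f y \<partial>\<mu> n k)) \<longlonglongrightarrow> Im (\<integral>y. ?f y \<partial>\<eta>)"
    using C0_tendsto[OF C0(2)] by (simp only: Im_eq[OF int_\<eta>])
  show ?thesis unfolding tendsto_complex_iff using Re Im by (simp add: Re_sum Im_sum)
qed

lemma cutoff_tendsto:
  "d > 0 \<Longrightarrow> (\<lambda>n. \<Sum>k=1..K n. (\<integral>y. torus_cutoff d y \<partial>\<mu> n k)) \<longlonglongrightarrow> (\<integral>y. torus_cutoff d y \<partial>\<eta>)"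
  using C0_tendsto[OF torus_cutoff_mult_C0[of d "\<lambda>_. 1"]] by simp

text \<open>The pointwise cutoff estimate at \<open>m = 0\<close>, where the shift term
  disappears.\<close>

lemma remainder_cutoff_\<eta>_le:
  assumes d: "0 < d" "d \<le> 1 / 2"
  shows "norm ((\<integral>y. centred_remainder l 0 y \<partial>\<eta>) - (\<integral>y. torus_cutoff d y * centred_remainder l 0 y \<partial>\<eta>))
    \<le> \<bar>real_of_int l\<bar> ^ 3 * (6 * d) * (\<integral>y. (torus_h y)\<^sup>2 \<partial>\<eta>)"
proof -
  let ?S = "centred_remainder l 0" and ?f = "\<lambda>y. torus_cutoff d y * centred_remainder l 0 y"
  let ?A = "\<bar>real_of_int l\<bar> ^ 3 * (6 * d)"
  note sets = levy_measure_sets[OF levy]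
  have le: "norm (?S y - ?f y) \<le> ?A * (torus_h y)\<^sup>2" if "y \<in> torus" for y
    using centred_remainder_cutoff_le[OF that, of 0 d l] d by simp
  have int: "integrable \<eta> ?S" "integrable \<eta> (\<lambda>y. ?A * (torus_h y)\<^sup>2)"
    using levy_measure_integrable_remainder[OF levy] levy_measure_integrable_h_sq[OF levy] by auto
  have int_diff: "integrable \<eta> (\<lambda>y. ?S y - ?f y)"
  proof (rule Bochner_Integration.integrable_bound[OF int(2)])
    show "(\<lambda>y. ?S y - ?f y) \<in> borel_measurable \<eta>"
      by (intro measurable_torus_continuous[OF sets] continuous_intros continuous_on_torus_cutoff
          continuous_on_centred_remainder)
    show "AE y in \<eta>. norm (?S y - ?f y) \<le> norm (?A * (torus_h y)\<^sup>2)"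
    proof (rule AE_I2)
      fix y assume "y \<in> space \<eta>"
      then have "y \<in> torus" by (simp add: space_eq_torus[OF sets])
      from order_trans[OF le[OF this] abs_ge_self]
      show "norm (?S y - ?f y) \<le> norm (?A * (torus_h y)\<^sup>2)" unfolding real_norm_def .
    qed
  qed
  from Bochner_Integration.integrable_diff[OF int(1) this] have "integrable \<eta> ?f" by simp
  then have "(\<integral>y. ?S y \<partial>\<eta>) - (\<integral>y. ?f y \<partial>\<eta>) = (\<integral>y. ?S y - ?f y \<partial>\<eta>)"
    using int(1) by simp
  moreover have "norm (\<integral>y. ?S y - ?f y \<partial>\<eta>) \<le> (\<integral>y. ?A * (torus_h y)\<^sup>2 \<partial>\<eta>)"
  proof (rule order_trans[OF integral_norm_bound])
    show "(\<integral>y. norm (?S y - ?f y) \<partial>\<eta>) \<le> (\<integral>y. ?A * (torus_h y)\<^sup>2 \<partial>\<eta>)"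
      using int_diff int(2) le
      by (intro integral_mono integrable_norm) (simp_all add: space_eq_torus[OF sets])
  qed
  ultimately show ?thesis by simp
qed

lemma row_remainder_cutoff_le:
  assumes d: "0 < d" "d \<le> 1 / 2" and k: "k \<in> {1..K n}"
  shows "norm ((\<integral>y. centred_remainder l (h_mean (\<mu> n k)) y \<partial>\<mu> n k)
      - (\<integral>y. torus_cutoff d y * centred_remainder l 0 y \<partial>\<mu> n k))
    \<le> \<bar>real_of_int l\<bar> ^ 3 * (6 * d + 3 * u n) * h_var (\<mu> n k)
      + (2 * \<bar>real_of_int l\<bar> + 3 * (real_of_int l)\<^sup>2) * (3 * u n) * (\<integral>y. torus_cutoff d y \<partial>\<mu> n k)"
  using abs_h_mean_le_u[OF k]
  by (intro order_trans[OF integral_centred_remainder_cutoff_le[OF prob[OF k] d]] add_mono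
      mult_right_mono mult_left_mono)
     (auto simp: h_var_nonneg torus_cutoff_bounds)

text \<open>For fixed \<open>d\<close> three errors arise: inserting the cutoff in the rows, passing
  to the limit by (iv), and removing the cutoff under \<eta>. Their total bound \<open>D n\<close>
  tends to a constant multiple of \<open>d\<close>.\<close>

lemma remainder_sum_tendsto:
  "(\<lambda>n. \<Sum>k=1..K n. (\<integral>y. centred_remainder l (h_mean (\<mu> n k)) y \<partial>\<mu> n k))
    \<longlonglongrightarrow> (\<integral>y. centred_remainder l 0 y \<partial>\<eta>)"
proof (rule LIMSEQ_I)
  fix r :: real assume r: "r > 0"
  let ?L = "\<bar>real_of_int l\<bar> ^ 3" and ?C = "2 * \<bar>real_of_int l\<bar> + 3 * (real_of_int l)\<^sup>2"
  let ?V = "\<lambda>n. \<Sum>k=1..K n. h_var (\<mu> n k)"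
  let ?S = "\<lambda>n. \<Sum>k=1..K n. (\<integral>y. centred_remainder l (h_mean (\<mu> n k)) y \<partial>\<mu> n k)"
  define Q where "Q = (\<integral>y. (torus_h y)\<^sup>2 \<partial>\<eta>)"
  \<comment> \<open>The limit of the total error is \<open>d\<close> times
    \<open>?L * 6 * (b + 2 * Q)\<close>: \<open>b + Q\<close> comes from the row variances, the
    other \<open>Q\<close> from \<eta>. The bound \<open>W\<close> is nonnegative, which permits a
    \<open>d\<close> with \<open>d * W < r\<close>.\<close>
  define W where "W = ?L * 6 * (\<bar>b\<bar> + 2 * Q)"
  have Q: "Q \<ge> 0" by (simp add: Q_def)
  then have W: "W \<ge> 0" by (simp add: W_def)
  define d where "d = min (1 / 2) (r / (2 * (W + 1)))"
  have d: "0 < d" "d \<le> 1 / 2" using r W by (simp add: d_def) (simp only: d_def min.cobounded1)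
  have "d * W \<le> r / (2 * (W + 1)) * W" using W by (intro mult_right_mono) (simp only: d_def min.cobounded2)
  also have "\<dots> < r" using r W by (simp add: field_simps) (smt (verit) mult_nonneg_nonneg)
  finally have dW: "d * W < r" .
  define \<Phi> where "\<Phi> n = (\<Sum>k=1..K n. (\<integral>y. torus_cutoff d y \<partial>\<mu> n k))" for n
  define F where "F n = (\<Sum>k=1..K n. (\<integral>y. torus_cutoff d y * centred_remainder l 0 y \<partial>\<mu> n k))" for n
  define J where "J = (\<integral>y. torus_cutoff d y * centred_remainder l 0 y \<partial>\<eta>)"
  define D where "D n = ?L * (6 * d + 3 * u n) * ?V n + ?C * (3 * u n) * \<Phi> n + norm (F n - J) + ?L * (6 * d) * Q" for n
  have F: "(\<lambda>n. norm (F n - J)) \<longlonglongrightarrow> norm (J - J)"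
    unfolding F_def J_def by (intro tendsto_norm tendsto_diff cutoff_remainder_tendsto d tendsto_const)
  have "D \<longlonglongrightarrow> ?L * (6 * d + 3 * 0) * (b + Q) + ?C * (3 * 0) * (\<integral>y. torus_cutoff d y \<partial>\<eta>)
      + norm (J - J) + ?L * (6 * d) * Q"
    unfolding D_def \<Phi>_def Q_def
    by (intro tendsto_intros u_tendsto var_tendsto cutoff_tendsto d F)
  moreover have "?L * (6 * d + 3 * 0) * (b + Q) + ?C * (3 * 0) * (\<integral>y. torus_cutoff d y \<partial>\<eta>)
      + norm (J - J) + ?L * (6 * d) * Q = d * (?L * 6 * (b + 2 * Q))"
    by (simp add: algebra_simps)
  moreover have "d * (?L * 6 * (b + 2 * Q)) \<le> d * W"
    unfolding W_def using d by (intro mult_left_mono) auto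
  ultimately obtain c where c: "D \<longlonglongrightarrow> c" "c < r" using le_less_trans[OF _ dW] by metis
  obtain N where N: "\<And>n. n \<ge> N \<Longrightarrow> D n < r"
    using order_tendstoD(2)[OF c] unfolding eventually_sequentially by blast
  have "norm (?S n - (\<integral>y. centred_remainder l 0 y \<partial>\<eta>)) \<le> D n" for n
  proof -
    have "norm (?S n - F n) \<le> (\<Sum>k=1..K n. ?L * (6 * d + 3 * u n) * h_var (\<mu> n k)
        + ?C * (3 * u n) * (\<integral>y. torus_cutoff d y \<partial>\<mu> n k))"
      unfolding F_def sum_subtractf[symmetric] by (rule sum_norm_le) (rule row_remainder_cutoff_le[OF d])
    also have "\<dots> = ?L * (6 * d + 3 * u n) * ?V n + ?C * (3 * u n) * \<Phi> n"
      unfolding \<Phi>_def sum.distrib sum_distrib_left ..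
    finally have 1: "norm (?S n - F n) \<le> \<dots>" .
    have 2: "norm ((\<integral>y. centred_remainder l 0 y \<partial>\<eta>) - J) \<le> ?L * (6 * d) * Q"
      unfolding J_def Q_def by (rule remainder_cutoff_\<eta>_le[OF d])
    have "norm (?S n - (\<integral>y. centred_remainder l 0 y \<partial>\<eta>))
        = norm ((?S n - F n) + (F n - J) + (J - (\<integral>y. centred_remainder l 0 y \<partial>\<eta>)))" by simp
    also have "\<dots> \<le> norm (?S n - F n) + norm (F n - J) + norm (J - (\<integral>y. centred_remainder l 0 y \<partial>\<eta>))"
      by (intro norm_triangle_mono order_refl)
    finally show ?thesis using 1 2 by (simp add: D_def norm_minus_commute)
  qed
  then show "\<exists>N. \<forall>n\<ge>N. norm (?S n - (\<integral>y. centred_remainder l 0 y \<partial>\<eta>)) < r"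
    using N by (intro exI[of _ N]) (auto intro: le_less_trans)
qed

text \<open>Convergence of the sums does not bound the sums of norms, so the estimates are repeated
  in absolute value at the fixed scale \<open>d = 1 / 2\<close>. The row sums of the majorant
  converge and are therefore bounded.\<close>

lemma centred_ft_sum_bounded:
  "\<exists>B. \<forall>n. (\<Sum>k=1..K n. norm (torus_ft (\<mu> n k) l * cis (- (l * h_mean (\<mu> n k))) - 1)) \<le> B"
proof -
  let ?L = "\<bar>real_of_int l\<bar> ^ 3" and ?C = "2 * \<bar>real_of_int l\<bar> + 3 * (real_of_int l)\<^sup>2"
  define d :: real where "d = 1 / 2"
  have d: "0 < d" "d \<le> 1 / 2" by (auto simp: d_def)
  obtain S where S: "\<And>y. y \<in> torus \<Longrightarrow> norm (centred_remainder l 0 y) \<le> S"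
    using torus_bounded[OF continuous_on_centred_remainder[of l 0]] by blast
  let ?g = "\<lambda>n k. ?L * (6 * d + 3 * u n) * h_var (\<mu> n k)
      + ?C * (3 * u n) * (\<integral>y. torus_cutoff d y \<partial>\<mu> n k) + S * (\<integral>y. torus_cutoff d y \<partial>\<mu> n k)
      + (real_of_int l)\<^sup>2 / 2 * h_var (\<mu> n k)"
  let ?G = "\<lambda>n. ?L * (6 * d + 3 * u n) * (\<Sum>k=1..K n. h_var (\<mu> n k))
      + ?C * (3 * u n) * (\<Sum>k=1..K n. (\<integral>y. torus_cutoff d y \<partial>\<mu> n k))
      + S * (\<Sum>k=1..K n. (\<integral>y. torus_cutoff d y \<partial>\<mu> n k))
      + (real_of_int l)\<^sup>2 / 2 * (\<Sum>k=1..K n. h_var (\<mu> n k))"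
  have "convergent ?G"
    unfolding convergent_def
  proof (rule exI)
    show "?G \<longlonglongrightarrow> ?L * (6 * d + 3 * 0) * (b + (\<integral>y. (torus_h y)\<^sup>2 \<partial>\<eta>))
        + ?C * (3 * 0) * (\<integral>y. torus_cutoff d y \<partial>\<eta>) + S * (\<integral>y. torus_cutoff d y \<partial>\<eta>)
        + (real_of_int l)\<^sup>2 / 2 * (b + (\<integral>y. (torus_h y)\<^sup>2 \<partial>\<eta>))"
      by (intro tendsto_add tendsto_mult tendsto_const u_tendsto var_tendsto cutoff_tendsto d)
  qed
  then obtain B where B: "\<And>n. norm (?G n) \<le> B"
    by (rule BseqE[OF convergent_imp_Bseq]) blast
  have le: "norm (torus_ft (\<mu> n k) l * cis (- (l * h_mean (\<mu> n k))) - 1) \<le> ?g n k" if k: "k \<in> {1..K n}" for n k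
  proof -
    let ?T = "\<integral>y. centred_remainder l (h_mean (\<mu> n k)) y \<partial>\<mu> n k"
    let ?F = "\<integral>y. torus_cutoff d y * centred_remainder l 0 y \<partial>\<mu> n k"
    have "norm ?F \<le> (\<integral>y. S * torus_cutoff d y \<partial>\<mu> n k)"
    proof (rule torus_prob_mono_integral[OF prob[OF k]])
      fix y :: complex assume "y \<in> torus"
      then show "norm (torus_cutoff d y * centred_remainder l 0 y) \<le> S * torus_cutoff d y"
        unfolding norm_mult norm_of_real using S[of y] torus_cutoff_bounds[of d y]
        by (subst mult.commute) (simp add: mult_right_mono)
    qed (intro continuous_intros continuous_on_torus_cutoff continuous_on_centred_remainder)+
    then have F: "norm ?F \<le> S * (\<integral>y. torus_cutoff d y \<partial>\<mu> n k)" by simp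
    have "norm (torus_ft (\<mu> n k) l * cis (- (l * h_mean (\<mu> n k))) - 1)
        = norm ((?T - ?F) + ?F - of_real ((real_of_int l)\<^sup>2 / 2 * h_var (\<mu> n k)))"
      unfolding centred_ft_eq[OF prob[OF k]] by simp
    also have "\<dots> \<le> norm (?T - ?F) + norm ?F + norm (complex_of_real ((real_of_int l)\<^sup>2 / 2 * h_var (\<mu> n k)))"
      by (intro norm_triangle_le_diff add_right_mono norm_triangle_ineq)
    also have "norm (complex_of_real ((real_of_int l)\<^sup>2 / 2 * h_var (\<mu> n k))) = (real_of_int l)\<^sup>2 / 2 * h_var (\<mu> n k)"
      unfolding norm_of_real using h_var_nonneg by simp
    finally show ?thesis using row_remainder_cutoff_le[OF d k, of l] F by linarith
  qed
  have "(\<Sum>k=1..K n. norm (torus_ft (\<mu> n k) l * cis (- (l * h_mean (\<mu> n k))) - 1)) \<le> B" for n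
  proof -
    have "(\<Sum>k=1..K n. norm (torus_ft (\<mu> n k) l * cis (- (l * h_mean (\<mu> n k))) - 1)) \<le> (\<Sum>k=1..K n. ?g n k)"
      by (rule sum_mono) (rule le)
    also have "\<dots> = ?G n" unfolding sum.distrib sum_distrib_left ..
    also have "\<dots> \<le> B" using B[of n] by simp
    finally show ?thesis .
  qed
  then show ?thesis by blast
qed

lemma centred_ft_prod_tendsto:
  "(\<lambda>n. \<Prod>k=1..K n. torus_ft (\<mu> n k) l * cis (- (l * h_mean (\<mu> n k))))
    \<longlonglongrightarrow> of_real (exp (- b * (of_int l)\<^sup>2 / 2)) *
      exp (\<integral>y. (y powi l - 1 - \<i> * of_real (torus_g y l)) \<partial>\<eta>)"
proof -
  define w where "w n k = torus_ft (\<mu> n k) l * cis (- (l * h_mean (\<mu> n k))) - 1" for n k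
  define s where "s = (\<integral>y. centred_remainder l 0 y \<partial>\<eta>)
    - of_real ((real_of_int l)\<^sup>2 / 2 * (b + (\<integral>y. (torus_h y)\<^sup>2 \<partial>\<eta>)))"
  obtain B where B: "\<And>n. (\<Sum>k=1..K n. norm (w n k)) \<le> B"
    using centred_ft_sum_bounded[of l] unfolding w_def by blast
  have "(\<lambda>n. \<Prod>k=1..K n. (1 + w n k)) \<longlonglongrightarrow> exp s"
  proof (rule tendsto_prod_one_plus_exp[where u = "\<lambda>n. 4 * \<bar>real_of_int l\<bar> * u n" and B = B])
    fix n k assume k: "k \<in> {1..K n}"
    show "norm (1 + w n k) \<le> 1"
      using norm_torus_ft_le_1[OF prob[OF k]] by (simp add: w_def norm_mult)
    have "norm (w n k) \<le> 4 * \<bar>real_of_int l\<bar> * (\<integral>y. norm (y - 1) \<partial>\<mu> n k)"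
      unfolding w_def by (rule norm_centred_ft_le[OF prob[OF k]])
    also have "\<dots> \<le> 4 * \<bar>real_of_int l\<bar> * u n"
      using dist_le[OF k] by (intro mult_left_mono) auto
    finally show "norm (w n k) \<le> 4 * \<bar>real_of_int l\<bar> * u n" .
  next
    show "(\<lambda>n. 4 * \<bar>real_of_int l\<bar> * u n) \<longlonglongrightarrow> 0"
      using tendsto_mult_left[OF u_tendsto, of "4 * \<bar>real_of_int l\<bar>"] by simp
    have "(\<lambda>n. (\<Sum>k=1..K n. (\<integral>y. centred_remainder l (h_mean (\<mu> n k)) y \<partial>\<mu> n k))
        - of_real ((real_of_int l)\<^sup>2 / 2 * (\<Sum>k=1..K n. h_var (\<mu> n k)))) \<longlonglongrightarrow> s"
      unfolding s_def by (intro tendsto_intros remainder_sum_tendsto var_tendsto)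
    moreover have "(\<Sum>k=1..K n. w n k) = (\<Sum>k=1..K n. (\<integral>y. centred_remainder l (h_mean (\<mu> n k)) y \<partial>\<mu> n k))
        - of_real ((real_of_int l)\<^sup>2 / 2 * (\<Sum>k=1..K n. h_var (\<mu> n k)))" for n
    proof -
      have "(\<Sum>k=1..K n. w n k) = (\<Sum>k=1..K n. (\<integral>y. centred_remainder l (h_mean (\<mu> n k)) y \<partial>\<mu> n k)
          - of_real ((real_of_int l)\<^sup>2 / 2 * h_var (\<mu> n k)))"
        unfolding w_def by (rule sum.cong[OF refl]) (rule centred_ft_eq[OF prob])
      then show ?thesis unfolding sum_subtractf sum_distrib_left of_real_sum .
    qed
    ultimately show "(\<lambda>n. \<Sum>k=1..K n. w n k) \<longlonglongrightarrow> s" by (simp only:)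
  qed (use B in auto)
  moreover
  have "s = of_real (- b * (of_int l)\<^sup>2 / 2)
      + (\<integral>y. (y powi l - 1 - \<i> * of_real (torus_g y l)) \<partial>\<eta>)"
    unfolding s_def levy_measure_integral_gen_poisson(2)[OF levy] by (simp add: field_simps)
  then have "exp s = of_real (exp (- b * (of_int l)\<^sup>2 / 2))
      * exp (\<integral>y. (y powi l - 1 - \<i> * of_real (torus_g y l)) \<partial>\<eta>)"
    by (simp only: exp_add exp_of_real)
  ultimately show ?thesis by (simp only: w_def add_diff_cancel_left' diff_add_cancel add.commute[of 1])
qed

text \<open>The sums of means need not converge, only their exponentials; an integer power of the
  latter restores the rotation that the centring removed.\<close>

theorem torus_ft_prod_tendsto:
  assumes a: "(\<lambda>n. exp (\<i> * of_real (\<Sum>k=1..K n. h_mean (\<mu> n k)))) \<longlonglongrightarrow> a" "a \<in> torus"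
  shows "(\<lambda>n. \<Prod>k=1..K n. torus_ft (\<mu> n k) l)
    \<longlonglongrightarrow> a powi l * of_real (exp (- b * (of_int l)\<^sup>2 / 2)) *
      exp (\<integral>y. (y powi l - 1 - \<i> * of_real (torus_g y l)) \<partial>\<eta>)"
proof -
  have "(\<Prod>k=1..K n. torus_ft (\<mu> n k) l) = exp (\<i> * of_real (\<Sum>k=1..K n. h_mean (\<mu> n k))) powi l *
      (\<Prod>k=1..K n. torus_ft (\<mu> n k) l * cis (- (l * h_mean (\<mu> n k))))" for n
  proof -
    have "exp (\<i> * of_real (\<Sum>k=1..K n. h_mean (\<mu> n k))) powi l = cis (\<Sum>k=1..K n. l * h_mean (\<mu> n k))"
      unfolding cis_conv_exp[symmetric] cis_power_int sum_distrib_left ..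
    also have "\<dots> = (\<Prod>k=1..K n. cis (l * h_mean (\<mu> n k)))"
      unfolding cis_conv_exp by (simp add: sum_distrib_left exp_sum)
    finally have "exp (\<i> * of_real (\<Sum>k=1..K n. h_mean (\<mu> n k))) powi l *
        (\<Prod>k=1..K n. torus_ft (\<mu> n k) l * cis (- (l * h_mean (\<mu> n k))))
      = (\<Prod>k=1..K n. cis (l * h_mean (\<mu> n k)) * (torus_ft (\<mu> n k) l * cis (- (l * h_mean (\<mu> n k)))))"
      by (simp only: prod.distrib)
    also have "\<dots> = (\<Prod>k=1..K n. torus_ft (\<mu> n k) l)"
    proof (rule prod.cong[OF refl])
      fix k
      have "cis (l * h_mean (\<mu> n k)) * cis (- (l * h_mean (\<mu> n k))) = 1" by (simp add: cis_mult)
      then show "cis (l * h_mean (\<mu> n k)) * (torus_ft (\<mu> n k) l * cis (- (l * h_mean (\<mu> n k)))) = torus_ft (\<mu> n k) l"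
        by (metis mult.left_commute mult.right_neutral)
    qed
    finally show ?thesis by simp
  qed
  moreover have "(\<lambda>n. exp (\<i> * of_real (\<Sum>k=1..K n. h_mean (\<mu> n k))) powi l) \<longlonglongrightarrow> a powi l"
    using a torus_nonzero by (intro tendsto_power_int) auto
  ultimately show ?thesis
    using tendsto_mult[OF _ centred_ft_prod_tendsto[of l]] by (simp only: mult.assoc)
qed

end

section \<open>Random arrays\<close>

lemma borel_nhd_one_dist:
  assumes "borel_nhd_one U"
  obtains r where "r > 0" "\<And>y. y \<in> torus \<Longrightarrow> norm (y - 1) < r \<Longrightarrow> y \<in> U"
proof -
  obtain V where V: "openin (top_of_set torus) V" "1 \<in> V" "V \<subseteq> U"
    using assms unfolding borel_nhd_one_def by blast
  then obtain T where T: "open T" "V = torus \<inter> T" unfolding openin_open by blast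
  with V(2) obtain r where r: "r > 0" "ball 1 r \<subseteq> T" using open_contains_ball[of T] by blast
  show ?thesis
  proof (rule that[OF r(1)])
    fix y :: complex assume "y \<in> torus" "norm (y - 1) < r"
    then have "y \<in> V" using r(2) T(2) by (auto simp: dist_norm norm_minus_commute)
    then show "y \<in> U" using V(3) by blast
  qed
qed

lemma norm_torus_minus_1_le:
  assumes "y \<in> torus"
  shows "norm (y - 1) \<le> \<bar>torus_arg y\<bar>"
  using norm_cis_minus_1_le[of "torus_arg y"] by (simp add: cis_torus_arg[OF assms])

lemma rowwise_independent_arrayD:
  assumes "rowwise_independent_array M K X" "n \<ge> 1"
  shows "prob_space (M n)" "1 \<le> K n" "\<And>k. k \<in> {1..K n} \<Longrightarrow> X n k \<in> measurable (M n) torus_borel"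
    "prob_space.indep_vars (M n) (\<lambda>_. torus_borel) (X n) {1..K n}"
  using assms unfolding rowwise_independent_array_def by blast+

lemma tail_set_measurable:
  assumes "X \<in> measurable N torus_borel"
  shows "{\<omega> \<in> space N. \<bar>torus_arg (X \<omega>)\<bar> > e} \<in> sets N"
proof -
  have [measurable]: "(\<lambda>\<omega>. torus_arg (X \<omega>)) \<in> borel_measurable N"
    by (rule measurable_compose[OF assms torus_arg_measurable])
  show ?thesis by measurable
qed

text \<open>A chord is no longer than its arc, so leaving a neighbourhood of \<open>1\<close> forces
  a large argument.\<close>

lemma infinitesimal_arrayI:
  assumes array: "rowwise_independent_array M K X"
    and tail: "\<And>\<epsilon>::real. \<epsilon> > 0 \<Longrightarrow>
      (\<lambda>n. MAX k\<in>{1..K n}. measure (M n) {\<omega> \<in> space (M n). \<bar>torus_arg (X n k \<omega>)\<bar> > \<epsilon>})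
        \<longlonglongrightarrow> 0"
  shows "infinitesimal_array M K X"
  unfolding infinitesimal_array_def
proof (intro allI impI)
  fix U assume "borel_nhd_one U"
  then obtain r where r: "r > 0" "\<And>y. y \<in> torus \<Longrightarrow> norm (y - 1) < r \<Longrightarrow> y \<in> U"
    using borel_nhd_one_dist by metis
  let ?p = "\<lambda>n k. measure (M n) {\<omega> \<in> space (M n). X n k \<omega> \<in> torus - U}"
  \<comment> \<open>Leaving \<open>U\<close> bounds the argument below by \<open>r\<close> only
    non-strictly, while the tail event is strict; hence \<open>r / 2\<close>.\<close>
  let ?q = "\<lambda>n k. measure (M n) {\<omega> \<in> space (M n). \<bar>torus_arg (X n k \<omega>)\<bar> > r / 2}"
  have "0 \<le> (MAX k\<in>{1..K n}. ?p n k) \<and> (MAX k\<in>{1..K n}. ?p n k) \<le> (MAX k\<in>{1..K n}. ?q n k)" if n: "n \<ge> 1" for n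
  proof -
    interpret prob_space "M n" by (rule rowwise_independent_arrayD[OF array n])
    have K: "1 \<in> {1..K n}" using rowwise_independent_arrayD(2)[OF array n] by simp
    have pq: "?p n k \<le> ?q n k" if k: "k \<in> {1..K n}" for k
    proof (rule finite_measure_mono)
      show "{\<omega> \<in> space (M n). X n k \<omega> \<in> torus - U} \<subseteq> {\<omega> \<in> space (M n). \<bar>torus_arg (X n k \<omega>)\<bar> > r / 2}"
      proof safe
        fix \<omega> assume \<omega>: "X n k \<omega> \<in> torus" "X n k \<omega> \<notin> U"
        then have "norm (X n k \<omega> - 1) \<ge> r" using r(2) not_le by blast
        then show "\<bar>torus_arg (X n k \<omega>)\<bar> > r / 2"
          using norm_torus_minus_1_le[OF \<omega>(1)] r(1) by linarith
      qed
    qed (rule tail_set_measurable[OF rowwise_independent_arrayD(3)[OF array n k]])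
    have "0 \<le> ?p n 1" by simp
    also have "\<dots> \<le> (MAX k\<in>{1..K n}. ?p n k)" using K by (intro Max_ge) auto
    finally have "0 \<le> (MAX k\<in>{1..K n}. ?p n k)" .
    moreover have "(MAX k\<in>{1..K n}. ?p n k) \<le> (MAX k\<in>{1..K n}. ?q n k)"
    proof (rule Max.boundedI)
      fix p assume "p \<in> ?p n ` {1..K n}"
      then obtain k where k: "k \<in> {1..K n}" "p = ?p n k" by blast
      have "?q n k \<le> (MAX k\<in>{1..K n}. ?q n k)" using k by (intro Max_ge) auto
      then show "p \<le> (MAX k\<in>{1..K n}. ?q n k)" using pq[OF k(1)] k(2) by linarith
    qed (use K in auto)
    ultimately show ?thesis ..
  qed
  then show "(\<lambda>n. MAX k\<in>{1..K n}. ?p n k) \<longlonglongrightarrow> 0"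
    using r(1)
    by (intro tendsto_sandwich[OF _ _ tendsto_const tail[of "r / 2"]] eventually_sequentiallyI[of 1]) auto
qed

text \<open>Off the tail event the chord is at most \<open>e\<close>, on it at most the diameter
  \<open>2\<close>. This turns smallness in probability into smallness in mean.\<close>

lemma dist_one_integral_le:
  assumes "prob_space N" and X: "X \<in> measurable N torus_borel" and e: "e > 0"
  shows "(\<integral>y. norm (y - 1) \<partial>distr N torus_borel X)
    \<le> e + 2 * measure N {\<omega> \<in> space N. \<bar>torus_arg (X \<omega>)\<bar> > e}"
proof -
  interpret prob_space N by fact
  let ?A = "{\<omega> \<in> space N. \<bar>torus_arg (X \<omega>)\<bar> > e}"
  have A: "?A \<in> sets N" by (rule tail_set_measurable[OF X])
  have ind: "integrable N (\<lambda>\<omega>. 2 * indicat_real ?A \<omega>)"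
    using A by (intro integrable_mult_right integrable_real_indicator) (auto simp: less_top[symmetric])
  have c: "continuous_on torus (\<lambda>y. norm (y - 1))" by (intro continuous_intros)
  have "(\<integral>y. norm (y - 1) \<partial>distr N torus_borel X) = (\<integral>\<omega>. norm (X \<omega> - 1) \<partial>N)"
    by (rule integral_distr[OF X measurable_torus_borel_continuous[OF c]])
  also have "\<dots> \<le> (\<integral>\<omega>. e + 2 * indicator ?A \<omega> \<partial>N)"
  proof (rule integral_mono)
    show "integrable N (\<lambda>\<omega>. norm (X \<omega> - 1))"
      using torus_prob_integrable[OF torus_prob_distr[OF assms(1) X] c]
        integrable_distr_eq[OF X measurable_torus_borel_continuous[OF c]] by simp
    show "integrable N (\<lambda>\<omega>. e + 2 * indicator ?A \<omega>)"
      using ind by simp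
    fix \<omega> assume \<omega>: "\<omega> \<in> space N"
    then have y: "X \<omega> \<in> torus" using measurable_space[OF X] by simp
    show "norm (X \<omega> - 1) \<le> e + 2 * indicator ?A \<omega>"
    proof (cases "\<omega> \<in> ?A")
      case True
      have "norm (X \<omega> - 1) \<le> 2" using norm_triangle_ineq4[of "X \<omega>" 1] y by simp
      then show ?thesis using True e by simp
    next
      case False
      then show ?thesis using norm_torus_minus_1_le[OF y] \<omega> by (simp add: not_less)
    qed
  qed
  also have "\<dots> = e + 2 * measure N ?A"
    using ind by (subst Bochner_Integration.integral_add) (auto simp: prob_space A)
  finally show ?thesis .
qed

text \<open>Plays the part of the bound \<open>u\<close> of the locale.\<close>

definition max_dist_one ::
  "(nat \<Rightarrow> 'a measure) \<Rightarrow> (nat \<Rightarrow> nat) \<Rightarrow> (nat \<Rightarrow> nat \<Rightarrow> 'a \<Rightarrow> complex) \<Rightarrow> nat \<Rightarrow> real" where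
  "max_dist_one M K X n = (MAX k\<in>{1..K n}. (\<integral>y. norm (y - 1) \<partial>distr (M n) torus_borel (X n k)))"

lemma max_dist_one_ge:
  "k \<in> {1..K n} \<Longrightarrow> (\<integral>y. norm (y - 1) \<partial>distr (M n) torus_borel (X n k)) \<le> max_dist_one M K X n"
  unfolding max_dist_one_def by (intro Max_ge) auto

lemma max_dist_one_nonneg:
  assumes "rowwise_independent_array M K X" "n \<ge> 1"
  shows "0 \<le> max_dist_one M K X n"
proof -
  have "0 \<le> (\<integral>y. norm (y - 1) \<partial>distr (M n) torus_borel (X n 1))" by simp
  also have "\<dots> \<le> max_dist_one M K X n"
    using rowwise_independent_arrayD(2)[OF assms] by (intro max_dist_one_ge) simp
  finally show ?thesis .
qed

lemma max_dist_one_tendsto: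
  assumes array: "rowwise_independent_array M K X"
    and tail: "\<And>\<epsilon>::real. \<epsilon> > 0 \<Longrightarrow>
      (\<lambda>n. MAX k\<in>{1..K n}. measure (M n) {\<omega> \<in> space (M n). \<bar>torus_arg (X n k \<omega>)\<bar> > \<epsilon>})
        \<longlonglongrightarrow> 0"
  shows "max_dist_one M K X \<longlonglongrightarrow> 0"
proof -
  let ?q = "\<lambda>e n k. measure (M n) {\<omega> \<in> space (M n). \<bar>torus_arg (X n k \<omega>)\<bar> > e}"
  let ?u = "max_dist_one M K X"
  show ?thesis
  proof (rule LIMSEQ_I)
    fix r :: real assume r: "r > 0"
    obtain N where N: "\<And>n. n \<ge> N \<Longrightarrow> \<bar>MAX k\<in>{1..K n}. ?q (r / 4) n k\<bar> < r / 4"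
      using LIMSEQ_D[OF tail[of "r / 4"], of "r / 4"] r by auto
    have "norm (?u n - 0) < r" if n: "n \<ge> max 1 N" for n
    proof -
      have n1: "n \<ge> 1" using n by simp
      have K: "1 \<in> {1..K n}" using rowwise_independent_arrayD(2)[OF array n1] by simp
      have "?u n \<le> r / 4 + 2 * (r / 4)"
        unfolding max_dist_one_def
      proof (rule Max.boundedI)
        fix v assume "v \<in> (\<lambda>k. \<integral>y. norm (y - 1) \<partial>distr (M n) torus_borel (X n k)) ` {1..K n}"
        then obtain k where k: "k \<in> {1..K n}" and v: "v = (\<integral>y. norm (y - 1) \<partial>distr (M n) torus_borel (X n k))" by blast
        have "v \<le> r / 4 + 2 * ?q (r / 4) n k"
          unfolding v using r rowwise_independent_arrayD[OF array n1] k by (intro dist_one_integral_le) auto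
        moreover have "?q (r / 4) n k \<le> (MAX k\<in>{1..K n}. ?q (r / 4) n k)" using k by (intro Max_ge) auto
        ultimately show "v \<le> r / 4 + 2 * (r / 4)" using N[of n] n by linarith
      qed (use K in auto)
      then show ?thesis using max_dist_one_nonneg[OF array n1] r by simp
    qed
    then show "\<exists>N. \<forall>n\<ge>N. norm (?u n - 0) < r" by blast
  qed
qed

lemma torus_ft_indep_prod:
  assumes N: "prob_space N" and fin: "finite I"
    and indep: "prob_space.indep_vars N (\<lambda>_. torus_borel) X I"
  shows "torus_prob (distr N torus_borel (\<lambda>\<omega>. \<Prod>k\<in>I. X k \<omega>))"
    and "torus_ft (distr N torus_borel (\<lambda>\<omega>. \<Prod>k\<in>I. X k \<omega>)) l
      = (\<Prod>k\<in>I. torus_ft (distr N torus_borel (X k)) l)"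
proof -
  interpret prob_space N by fact
  have X: "X k \<in> measurable N torus_borel" if "k \<in> I" for k
    using indep that unfolding indep_vars_def by blast
  have meas: "(\<lambda>\<omega>. \<Prod>k\<in>I. X k \<omega>) \<in> measurable N torus_borel"
  proof (rule measurable_into_torus_borel)
    show "(\<lambda>\<omega>. \<Prod>k\<in>I. X k \<omega>) \<in> borel_measurable N"
      by (rule borel_measurable_prod) (rule measurable_into_borel[OF X])
    fix \<omega> assume "\<omega> \<in> space N"
    then show "(\<Prod>k\<in>I. X k \<omega>) \<in> torus"
      using measurable_space[OF X] by (simp add: prod_norm[symmetric])
  qed
  show "torus_prob (distr N torus_borel (\<lambda>\<omega>. \<Prod>k\<in>I. X k \<omega>))"
    by (rule torus_prob_distr[OF N meas])
  have prod_powi: "(\<Prod>k\<in>I. X k \<omega>) powi l = (\<Prod>k\<in>I. X k \<omega> powi l)" for \<omega>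
    using fin by (induction I rule: finite_induct) (simp_all add: power_int_mult_distrib)
  have indep': "indep_vars (\<lambda>_. borel) (\<lambda>k \<omega>. X k \<omega> powi l) I"
    by (rule indep_vars_compose2[OF indep]) (rule measurable_torus_borel_continuous[OF continuous_on_torus_powi])
  have int: "integrable N (\<lambda>\<omega>. X k \<omega> powi l)" if "k \<in> I" for k
    using torus_prob_integrable[OF torus_prob_distr[OF N X[OF that]] continuous_on_torus_powi[of l]]
      integrable_distr_eq[OF X[OF that] measurable_torus_borel_continuous[OF continuous_on_torus_powi]] by simp
  have "torus_ft (distr N torus_borel (\<lambda>\<omega>. \<Prod>k\<in>I. X k \<omega>)) l = (\<integral>\<omega>. (\<Prod>k\<in>I. X k \<omega> powi l) \<partial>N)"
    unfolding torus_ft_distr[OF meas] prod_powi ..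
  also have "\<dots> = (\<Prod>k\<in>I. \<integral>\<omega>. X k \<omega> powi l \<partial>N)"
    by (rule indep_vars_lebesgue_integral[OF fin indep' int])
  also have "\<dots> = (\<Prod>k\<in>I. torus_ft (distr N torus_borel (X k)) l)"
    by (rule prod.cong[OF refl]) (simp add: torus_ft_distr[OF X])
  finally show "torus_ft (distr N torus_borel (\<lambda>\<omega>. \<Prod>k\<in>I. X k \<omega>)) l
      = (\<Prod>k\<in>I. torus_ft (distr N torus_borel (X k)) l)" .
qed

lemma integral_distr_torus:
  fixes f :: "complex \<Rightarrow> real"
  assumes "X \<in> measurable N torus_borel" "continuous_on torus f"
  shows "(\<integral>y. f y \<partial>distr N torus_borel X) = (\<integral>\<omega>. f (X \<omega>) \<partial>N)"
  by (rule integral_distr[OF assms(1) measurable_torus_borel_continuous[OF assms(2)]])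

lemma h_mean_distr:
  assumes X: "X \<in> measurable N torus_borel"
  shows "h_mean (distr N torus_borel X) = (\<integral>\<omega>. trunc_h (torus_arg (X \<omega>)) \<partial>N)"
proof -
  have "h_mean (distr N torus_borel X) = (\<integral>\<omega>. torus_h (X \<omega>) \<partial>N)"
    unfolding h_mean_def by (rule integral_distr_torus[OF X continuous_on_torus_h])
  also have "\<dots> = (\<integral>\<omega>. trunc_h (torus_arg (X \<omega>)) \<partial>N)"
  proof (rule Bochner_Integration.integral_cong[OF refl])
    fix \<omega> assume "\<omega> \<in> space N"
    then have "X \<omega> \<in> torus" using measurable_space[OF X] by simp
    then show "torus_h (X \<omega>) = trunc_h (torus_arg (X \<omega>))"
      by (simp only: trunc_h_torus_arg torus_h_def)
  qed
  finally show ?thesis .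
qed

lemma h_var_distr:
  assumes X: "X \<in> measurable N torus_borel"
  shows "h_var (distr N torus_borel X)
    = (\<integral>\<omega>. (trunc_h (torus_arg (X \<omega>)) - (\<integral>\<omega>. trunc_h (torus_arg (X \<omega>)) \<partial>N))\<^sup>2 \<partial>N)"
proof -
  let ?m = "h_mean (distr N torus_borel X)"
  have "h_var (distr N torus_borel X) = (\<integral>\<omega>. (torus_h (X \<omega>) - ?m)\<^sup>2 \<partial>N)"
    unfolding h_var_def by (rule integral_distr_torus[OF X]) (intro continuous_intros continuous_on_torus_h)
  also have "\<dots> = (\<integral>\<omega>. (trunc_h (torus_arg (X \<omega>)) - ?m)\<^sup>2 \<partial>N)"
  proof (rule Bochner_Integration.integral_cong[OF refl])
    fix \<omega> assume "\<omega> \<in> space N"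
    then have "X \<omega> \<in> torus" using measurable_space[OF X] by simp
    then show "(torus_h (X \<omega>) - ?m)\<^sup>2 = (trunc_h (torus_arg (X \<omega>)) - ?m)\<^sup>2"
      by (simp only: trunc_h_torus_arg torus_h_def)
  qed
  finally show ?thesis unfolding h_mean_distr[OF X] .
qed

theorem theorem6p1:
  fixes M :: "nat \<Rightarrow> 'a measure"
    and K :: "nat \<Rightarrow> nat"
    and X :: "nat \<Rightarrow> nat \<Rightarrow> 'a \<Rightarrow> complex"
    and a :: complex and b :: real and \<eta> :: "complex measure"
  assumes "rowwise_independent_array M K X"
    and "a \<in> torus" and "b \<ge> 0" and "levy_measure \<eta>"
    and "\<And>\<epsilon>::real. \<epsilon> > 0 \<Longrightarrow>
      (\<lambda>n. MAX k\<in>{1..K n}. measure (M n) {\<omega> \<in> space (M n). \<bar>torus_arg (X n k \<omega>)\<bar> > \<epsilon>})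
        \<longlonglongrightarrow> 0"
    and "(\<lambda>n. exp (\<i> * of_real
        (\<Sum>k=1..K n. prob_space.expectation (M n) (\<lambda>\<omega>. trunc_h (torus_arg (X n k \<omega>))))))
      \<longlonglongrightarrow> a"
    and "(\<lambda>n. \<Sum>k=1..K n. prob_space.variance (M n) (\<lambda>\<omega>. trunc_h (torus_arg (X n k \<omega>))))
      \<longlonglongrightarrow> b + (\<integral>y. (trunc_h (torus_arg y))\<^sup>2 \<partial>\<eta>)"
    and "\<And>f. f \<in> torus_C0 \<Longrightarrow>
      (\<lambda>n. \<Sum>k=1..K n. prob_space.expectation (M n) (\<lambda>\<omega>. f (X n k \<omega>)))
        \<longlonglongrightarrow> (\<integral>y. f y \<partial>\<eta>)"
  shows "infinitesimal_array M K X \<and>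
    torus_weak_conv
      (\<lambda>n. distr (M n) torus_borel (\<lambda>\<omega>. \<Prod>k=1..K n. X n k \<omega>))
      (torus_convolution
        (torus_convolution (return torus_borel a) (gauss_measure b))
        (gen_poisson_measure \<eta>))"
proof
  note array = assms(1) and a = assms(2) and b = assms(3) and levy = assms(4) and tail = assms(5)
  show "infinitesimal_array M K X" by (rule infinitesimal_arrayI[OF array tail])
  let ?law = "\<lambda>n. distr (M n) torus_borel (\<lambda>\<omega>. \<Prod>k=1..K n. X n k \<omega>)"
  let ?lim = "torus_convolution (torus_convolution (return torus_borel a) (gauss_measure b)) (gen_poisson_measure \<eta>)"
  \<comment> \<open>The hypotheses on the array start at row \<open>1\<close>, whereas the locale
    speaks of every \<open>n\<close>; hence the shift to \<open>Suc n\<close>.\<close>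
  define \<mu> where "\<mu> n k = distr (M (Suc n)) torus_borel (X (Suc n) k)" for n k

  have row: "prob_space (M (Suc n))" "k \<in> {1..K (Suc n)} \<Longrightarrow> X (Suc n) k \<in> measurable (M (Suc n)) torus_borel"
    "prob_space.indep_vars (M (Suc n)) (\<lambda>_. torus_borel) (X (Suc n)) {1..K (Suc n)}" for n k
    using rowwise_independent_arrayD[OF array, of "Suc n"] by auto
  have h_eq: "(\<integral>y. (trunc_h (torus_arg y))\<^sup>2 \<partial>\<eta>) = (\<integral>y. (torus_h y)\<^sup>2 \<partial>\<eta>)"
    by (rule torus_integral_cong[OF levy_measure_sets[OF levy]]) (simp only: trunc_h_torus_arg torus_h_def)
  let ?u = "max_dist_one M K X"
  interpret torus_triangular_array \<mu> "\<lambda>n. K (Suc n)" b \<eta> "\<lambda>n. ?u (Suc n)"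
  proof
    show "torus_prob (\<mu> n k)" if "k \<in> {1..K (Suc n)}" for n k
      unfolding \<mu>_def using row that by (intro torus_prob_distr) auto
    show "(\<integral>y. norm (y - 1) \<partial>\<mu> n k) \<le> ?u (Suc n)" if "k \<in> {1..K (Suc n)}" for n k
      unfolding \<mu>_def using that by (rule max_dist_one_ge)

    have "?u \<longlonglongrightarrow> 0" by (rule max_dist_one_tendsto[OF array tail])
    then show "(\<lambda>n. ?u (Suc n)) \<longlonglongrightarrow> 0" by (rule LIMSEQ_Suc)
    have "(\<Sum>k=1..K (Suc n). h_var (\<mu> n k))
        = (\<Sum>k=1..K (Suc n). prob_space.variance (M (Suc n)) (\<lambda>\<omega>. trunc_h (torus_arg (X (Suc n) k \<omega>))))" for n
      unfolding \<mu>_def by (rule sum.cong[OF refl]) (rule h_var_distr[OF row(2)])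
    then show "(\<lambda>n. \<Sum>k=1..K (Suc n). h_var (\<mu> n k)) \<longlonglongrightarrow> b + (\<integral>y. (torus_h y)\<^sup>2 \<partial>\<eta>)"
      using LIMSEQ_Suc[OF assms(7)] unfolding h_eq by (simp only:)
    fix f :: "complex \<Rightarrow> real" assume f: "f \<in> torus_C0"
    then have c: "continuous_on torus f" by (simp add: torus_C0_def)
    have "(\<Sum>k=1..K (Suc n). (\<integral>y. f y \<partial>\<mu> n k))
        = (\<Sum>k=1..K (Suc n). prob_space.expectation (M (Suc n)) (\<lambda>\<omega>. f (X (Suc n) k \<omega>)))" for n
      unfolding \<mu>_def by (rule sum.cong[OF refl]) (rule integral_distr_torus[OF row(2) c])
    then show "(\<lambda>n. \<Sum>k=1..K (Suc n). (\<integral>y. f y \<partial>\<mu> n k)) \<longlonglongrightarrow> (\<integral>y. f y \<partial>\<eta>)"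
      using LIMSEQ_Suc[OF assms(8)[OF f]] by (simp only:)
  qed (rule levy)
  have "(\<Sum>k=1..K (Suc n). h_mean (\<mu> n k))
      = (\<Sum>k=1..K (Suc n). prob_space.expectation (M (Suc n)) (\<lambda>\<omega>. trunc_h (torus_arg (X (Suc n) k \<omega>))))" for n
    unfolding \<mu>_def by (rule sum.cong[OF refl]) (rule h_mean_distr[OF row(2)])
  then have a_lim: "(\<lambda>n. exp (\<i> * of_real (\<Sum>k=1..K (Suc n). h_mean (\<mu> n k)))) \<longlonglongrightarrow> a"
    using LIMSEQ_Suc[OF assms(6)] by (simp only:)
  have lim: "torus_prob ?lim"
    by (intro torus_prob_convolution torus_prob_return a gauss_measure_ft b gen_poisson_measure_ft levy)
  have lim_ft: "torus_ft ?lim l = a powi l * of_real (exp (- b * (of_int l)\<^sup>2 / 2)) *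
      exp (\<integral>y. (y powi l - 1 - \<i> * of_real (torus_g y l)) \<partial>\<eta>)" for l
    by (simp only: torus_prob_convolution torus_prob_return torus_ft_return a gauss_measure_ft[OF b]
        gen_poisson_measure_ft[OF levy])
  have "torus_weak_conv (\<lambda>n. ?law (Suc n)) ?lim"
  proof (rule torus_weak_conv_if_ft_tendsto[OF _ lim])
    show "torus_prob (?law (Suc n))" for n
      by (rule torus_ft_indep_prod[OF row(1) _ row(3)]) simp
    have "torus_ft (?law (Suc n)) l = (\<Prod>k=1..K (Suc n). torus_ft (\<mu> n k) l)" for n l
      unfolding \<mu>_def by (rule torus_ft_indep_prod[OF row(1) _ row(3)]) simp
    then show "(\<lambda>n. torus_ft (?law (Suc n)) l) \<longlonglongrightarrow> torus_ft ?lim l" for l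
      using torus_ft_prod_tendsto[OF a_lim a] unfolding lim_ft by (simp only:)
  qed
  \<comment> \<open>Undoing the shift: a first term does not affect the limit of a sequence of
    integrals.\<close>
  then show "torus_weak_conv ?law ?lim"
    unfolding torus_weak_conv_def
    using filterlim_sequentially_Suc[of "\<lambda>n. \<integral>y. _ y \<partial>?law n"] by blast
qed

end
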